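(* Let $\{Z_n:n\geq 0\}$ be a critical Galton--Watson process in a varying environment $Q=\{q_n:n\ge1\}$, i.e. $\rho_{0,n}\to\infty$ and $\mu_n\rho_{0,n}\to\infty$ as $n\to\infty$. Assume that there exists $c>0$ such that $$f_n'''(1)\leq c\, f_n''(1)\,(1+f_n'(1))\qquad\text{for all } n\geq 1.$$ Define $b_n:=\mathbb{E}[Z_n\mid Z_n>0]$ and, for $n\ge 2$, $$r_n:=\sum_{j=1}^{n-1}\frac{\nu_j}{\mu_{j-1}}\,\frac{1+f_j'(1)}{\mu_j(\rho_{0,n}-\rho_{0,j})}+\frac{\nu_n}{\mu_{n-1}}\left(1+f_n'(1)\right).$$ Then there exists a constant $C>0$, independent of $n$, such that for all $n\geq 2$ $$d_W\left(\left\{\left.\frac{1}{b_n}Z_n\ \right|\ Z_n>0\right\},\mathbf{e}\right)\leq C\left(\frac{1}{\mu_n\rho_{0,n}}+\frac{r_n}{\rho_{0,n}}\right),$$ where $\mathbf{e}$ is a standard exponential random variable.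
   Context: An environment is a sequence $Q=\{q_n:n\geq1\}$ of probability measures on $\mathbb{N}_0=\{0,1,2,\dots\}$. The Galton--Watson process in the varying environment $Q$ (GWVE) is defined by $Z_0=1$ and $Z_n=\sum_{i=1}^{Z_{n-1}}\chi_i^{(n)}$, $n\geq1$, where $\{\chi_i^{(n)}:i,n\geq1\}$ are independent and $\chi_i^{(n)}$ has law $q_n$. It is assumed throughout that $0<\mathbb{E}[\chi_i^{(n)}]<\infty$ and that $q_n$ has finite second moment for every $n$. Let $f_n(s)=\sum_{k\ge0}s^kq_n[k]$, $0\le s\le 1$, be the generating function of $q_n$ (so $f_n'(1),f_n''(1),f_n'''(1)$ are its first, second and third factorial moments). Set $\mu_0:=1$, $\rho_{0,0}:=0$ and, for $n\geq1$, $$\mu_n:=f_1'(1)\cdots f_n'(1),\qquad \nu_n:=\frac{f_n''(1)}{f_n'(1)^2},\qquad \rho_{0,n}:=\sum_{k=0}^{n-1}\frac{\nu_{k+1}}{\mu_k}.$$ Convention: where denominators vanish, $a/0=+\infty$ for $a>0$, and a summand of $r_n$ with $\nu_j=0$ equals $0$; a bound whose right-hand side is $+\infty$ is vacuous. $\{X\mid Z_n>0\}$ denotes the conditional law of $X$ given $\{Z_n>0\}$. The Wasserstein distance between probability measures $\mu,\nu$ on $\mathbb{R}$ is $d_W(\mu,\nu)=\sup_{f\in\mathcal{F}}\left|\int f\,d\mu-\int f\,d\nu\right|$, where $\mathcal{F}$ is the set of Lipschitz functions $f:\mathbb{R}\to\mathbb{R}$ with $\|f'\|_\infty\leq1$;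 for random variables it means the distance of their laws. *)

theory Defs
  imports "HOL-Probability.Probability"
begin

section \<open>Environments\<close>

text \<open>
  The j-th factorial moment, i.e. the j-th (left) derivative at 1 of the generating function
  \<open>f(s) = (\<Sum>k. s^k * pmf p k)\<close>; it is \<open>\<infinity>\<close> if the defining series diverges.
  The truncated subtraction is harmless: for \<open>k < j\<close> the product contains the factor
  \<open>k - k = 0\<close>.
\<close>

definition factorial_moment :: "nat \<Rightarrow> nat pmf \<Rightarrow> ennreal" where
  "factorial_moment j p = (\<integral>\<^sup>+ k. of_nat (\<Prod>i<j. k - i) \<partial>measure_pmf p)"

text \<open>
  An environment is a sequence \<open>q\<close> of laws on the natural numbers of which only the members with
  index at least 1 matter; \<open>q 0\<close> is never used.
\<close>

definition environment :: "(nat \<Rightarrow> nat pmf) \<Rightarrow> bool" where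
  "environment q \<longleftrightarrow> (\<forall>n\<ge>1.
     0 < (\<integral>\<^sup>+ k. of_nat k \<partial>measure_pmf (q n)) \<and>
     (\<integral>\<^sup>+ k. of_nat k \<partial>measure_pmf (q n)) < \<infinity> \<and>
     (\<integral>\<^sup>+ k. of_nat (k ^ 2) \<partial>measure_pmf (q n)) < \<infinity>)"

text \<open>\<open>fd1 q n\<close> and \<open>fd2 q n\<close> are \<open>f\<^sub>n'(1)\<close> and \<open>f\<^sub>n''(1)\<close>, both finite in an environment.\<close>

definition fd1 :: "(nat \<Rightarrow> nat pmf) \<Rightarrow> nat \<Rightarrow> real" where
  "fd1 q n = enn2real (factorial_moment 1 (q n))"

definition fd2 :: "(nat \<Rightarrow> nat pmf) \<Rightarrow> nat \<Rightarrow> real" where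
  "fd2 q n = enn2real (factorial_moment 2 (q n))"

definition mu :: "(nat \<Rightarrow> nat pmf) \<Rightarrow> nat \<Rightarrow> real" where
  "mu q n = (\<Prod>k=1..n. fd1 q k)"

definition nu :: "(nat \<Rightarrow> nat pmf) \<Rightarrow> nat \<Rightarrow> real" where
  "nu q n = fd2 q n / (fd1 q n)\<^sup>2"

definition rho :: "(nat \<Rightarrow> nat pmf) \<Rightarrow> nat \<Rightarrow> real" where
  "rho q n = (\<Sum>k<n. nu q (k + 1) / mu q k)"

definition critical :: "(nat \<Rightarrow> nat pmf) \<Rightarrow> bool" where
  "critical q \<longleftrightarrow>
     filterlim (rho q) at_top sequentially \<and>
     filterlim (\<lambda>n. mu q n * rho q n) at_top sequentially"

text \<open>
  The denominators \<open>rho q n - rho q j\<close> can vanish. In \<^typ>\<open>ennreal\<close> we have \<open>a / 0 = \<infinity>\<close> for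
  \<open>a > 0\<close> and \<open>0 * \<infinity> = 0\<close>, so that a summand with \<open>nu q j = 0\<close> is 0.
\<close>

definition remainder :: "(nat \<Rightarrow> nat pmf) \<Rightarrow> nat \<Rightarrow> ennreal" where
  "remainder q n =
     (\<Sum>j=1..n-1. ennreal (nu q j / mu q (j - 1)) *
        (ennreal (1 + fd1 q j) / ennreal (mu q j * (rho q n - rho q j)))) +
     ennreal (nu q n / mu q (n - 1) * (1 + fd1 q n))"

section \<open>The Galton--Watson process in a varying environment\<close>

definition offspring_family ::
    "'a measure \<Rightarrow> (nat \<Rightarrow> nat pmf) \<Rightarrow> (nat \<Rightarrow> nat \<Rightarrow> 'a \<Rightarrow> nat) \<Rightarrow> bool" where
  "offspring_family M q \<xi> \<longleftrightarrow>
     prob_space.indep_vars M (\<lambda>_. count_space UNIV) (\<lambda>(n, i). \<xi> n i) ({1..} \<times> {1..}) \<and>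
     (\<forall>n\<ge>1. \<forall>i\<ge>1. distr M (count_space UNIV) (\<xi> n i) = measure_pmf (q n))"

primrec gw_process :: "(nat \<Rightarrow> nat \<Rightarrow> 'a \<Rightarrow> nat) \<Rightarrow> nat \<Rightarrow> 'a \<Rightarrow> nat" where
  "gw_process \<xi> 0 \<omega> = 1"
| "gw_process \<xi> (Suc n) \<omega> = (\<Sum>i=1..gw_process \<xi> n \<omega>. \<xi> (Suc n) i \<omega>)"

definition cond_survival ::
    "'a measure \<Rightarrow> (nat \<Rightarrow> nat \<Rightarrow> 'a \<Rightarrow> nat) \<Rightarrow> nat \<Rightarrow> 'a measure" where
  "cond_survival M \<xi> n = uniform_measure M {\<omega> \<in> space M. gw_process \<xi> n \<omega> > 0}"

definition cond_mean ::
    "'a measure \<Rightarrow> (nat \<Rightarrow> nat \<Rightarrow> 'a \<Rightarrow> nat) \<Rightarrow> nat \<Rightarrow> real" where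
  "cond_mean M \<xi> n = (\<integral>\<omega>. real (gw_process \<xi> n \<omega>) \<partial>cond_survival M \<xi> n)"

section \<open>The Wasserstein distance\<close>

text \<open>
  A Lipschitz function is differentiable almost everywhere, so \<open>\<parallel>f'\<parallel>\<^sub>\<infinity> \<le> 1\<close> refers to the almost
  everywhere defined derivative.
\<close>

definition wasserstein_test :: "(real \<Rightarrow> real) set" where
  "wasserstein_test = {f. (\<exists>L. L-lipschitz_on UNIV f) \<and>
     (AE x in lborel. f differentiable (at x) \<and> \<bar>deriv f x\<bar> \<le> 1)}"

text \<open>
  Meaningful for Borel probability measures with finite first moment, for which all the integrals
  exist. The supremum is taken in \<^typ>\<open>ennreal\<close>, so it has no default value for unbounded sets.
\<close>

definition wasserstein_dist :: "real measure \<Rightarrow> real measure \<Rightarrow> ennreal" where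
  "wasserstein_dist P Q =
     (SUP f\<in>wasserstein_test. ennreal \<bar>(\<integral>x. f x \<partial>P) - (\<integral>x. f x \<partial>Q)\<bar>)"

end

theory Submission imports Defs begin

text \<open>
  For a law \<open>p\<close> on the natural numbers with generating function \<open>f\<close> let \<open>V\<^sub>a(p)\<close> be the law whose
  generating function is proportional to the divided difference \<open>(f(t) - f(a)) / (t - a)\<close>. If \<open>Z\<close> has
  law \<open>p\<close>, then \<open>V\<^sub>0(p)\<close> is the law of \<open>Z - 1\<close> given \<open>Z > 0\<close>, and \<open>V\<^sub>1(p)\<close> is its (discrete) equilibrium
  law, so that by Stein's method for the exponential law it suffices to bound the Wasserstein distance
  of \<open>V\<^sub>0(p)\<close> and \<open>V\<^sub>1(p)\<close> for the law \<open>p\<close> of \<open>Z\<^sub>n\<close>. The chain rule for divided differences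
  decomposes \<open>V\<^sub>a(p)\<close> along the generations: with \<open>r\<close> the law at time \<open>n\<close> of the descendants of an
  individual of generation \<open>k\<close> and \<open>g\<close> its generating function, generation \<open>k\<close> contributes the
  descendants of \<open>V\<^bsub>g(a)\<^esub>(q\<^sub>k)\<close> individuals. Hence the distance is at most the sum over \<open>k\<close> of
  \<open>\<mu>\<^sub>n / \<mu>\<^sub>k\<close> times the distance of \<open>V\<^bsub>g(0)\<^esub>(q\<^sub>k)\<close> and \<open>V\<^sub>1(q\<^sub>k)\<close>. The latter is proportional to
  the survival probability \<open>1 - g(0)\<close>, which Kersting's shape function bounds by a multiple of
  \<open>1 / (\<mu>\<^sub>k (\<rho>\<^bsub>0,n\<^esub> - \<rho>\<^bsub>0,k\<^esub>))\<close>.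
\<close>

section \<open>Compound laws and divided differences\<close>

primrec iid_sum :: "nat pmf \<Rightarrow> nat \<Rightarrow> nat pmf" where
  "iid_sum q 0 = return_pmf 0"
| "iid_sum q (Suc m) = bind_pmf (iid_sum q m) (\<lambda>s. map_pmf (\<lambda>x. s + x) q)"

definition compound :: "nat pmf \<Rightarrow> nat pmf \<Rightarrow> nat pmf" where
  "compound p q = bind_pmf p (iid_sum q)"

lemma iid_sum_add:
  "iid_sum q (m + n) = bind_pmf (iid_sum q m) (\<lambda>s. map_pmf (\<lambda>t. s + t) (iid_sum q n))"
proof (induction n)
  case 0
  then show ?case by (simp add: map_pmf_def bind_return_pmf bind_return_pmf')
next
  case (Suc n)
  then show ?case
    by (simp add: map_pmf_def bind_assoc_pmf bind_return_pmf add.assoc)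
qed

text \<open>The last family size may be drawn after the offspring of the earlier families, so the
  second generation again splits into one independent compound sum per family.\<close>

lemma bind_iid_sum_iid_sum: "bind_pmf (iid_sum q m) (iid_sum r) = iid_sum (compound q r) m"
proof (induction m)
  case 0
  then show ?case by (simp add: bind_return_pmf)
next
  case (Suc m)
  have "bind_pmf (iid_sum q (Suc m)) (iid_sum r)
      = bind_pmf (iid_sum q m) (\<lambda>s. bind_pmf q (\<lambda>x. bind_pmf (iid_sum r s)
          (\<lambda>a. map_pmf (\<lambda>t. a + t) (iid_sum r x))))"
    by (simp add: bind_assoc_pmf bind_map_pmf iid_sum_add)
  also have "\<dots> = bind_pmf (iid_sum q m) (\<lambda>s. bind_pmf (iid_sum r s)
          (\<lambda>a. bind_pmf q (\<lambda>x. map_pmf (\<lambda>t. a + t) (iid_sum r x))))"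
    by (subst bind_commute_pmf) (rule refl)
  also have "\<dots> = bind_pmf (bind_pmf (iid_sum q m) (iid_sum r))
          (\<lambda>a. map_pmf (\<lambda>t. a + t) (compound q r))"
    by (simp add: bind_assoc_pmf compound_def map_bind_pmf)
  finally show ?case by (simp add: Suc)
qed

text \<open>Regrouping the last generation by family. It lets a line of descent be split at its
  first or at its last generation.\<close>

lemma compound_assoc: "compound (compound p q) r = compound p (compound q r)"
  by (simp add: compound_def[of p] compound_def[of "bind_pmf p (iid_sum q)"]
      bind_assoc_pmf bind_iid_sum_iid_sum)

lemma iid_sum_return_1: "iid_sum (return_pmf 1) m = return_pmf m"
  by (induction m) (simp_all add: bind_return_pmf)

lemma compound_return_right: "compound p (return_pmf 1) = p"
proof -
  have "iid_sum (return_pmf 1) = return_pmf" using iid_sum_return_1 by (rule ext)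
  then show ?thesis by (simp add: compound_def bind_return_pmf')
qed

lemma compound_return_left: "compound (return_pmf 1) q = q"
  by (simp add: compound_def bind_return_pmf map_pmf_idI)

lemma nn_integral_compound: "(\<integral>\<^sup>+ x. h x \<partial>measure_pmf (compound p q)) =
    (\<integral>\<^sup>+ m. \<integral>\<^sup>+ x. h x \<partial>measure_pmf (iid_sum q m) \<partial>measure_pmf p)"
  by (simp add: compound_def)

section \<open>Generating functions, divided differences and their chain rule\<close>

definition egf :: "nat pmf \<Rightarrow> ennreal \<Rightarrow> ennreal" where
  "egf p a = (\<integral>\<^sup>+ j. a ^ j \<partial>measure_pmf p)"

lemma nn_integral_iid_sum_power: "(\<integral>\<^sup>+ s. a ^ s \<partial>measure_pmf (iid_sum q m)) = egf q a ^ m"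
  by (induction m) (simp_all add: power_add nn_integral_cmult nn_integral_multc egf_def mult.commute)

lemma egf_compound: "egf (compound p q) a = egf p (egf q a)"
  by (simp add: egf_def[of "compound p q"] egf_def[of p] nn_integral_compound nn_integral_iid_sum_power)

lemma nn_integral_iid_sum: "(\<integral>\<^sup>+ s. of_nat s \<partial>measure_pmf (iid_sum q m)) =
    of_nat m * (\<integral>\<^sup>+ x. of_nat x \<partial>measure_pmf q)"
  by (induction m) (simp_all add: nn_integral_add algebra_simps)

text \<open>For \<open>h m = t ^ m\<close> this is the divided difference (t^j - a^j) / (t - a). For
  general \<open>h\<close> it is the integral of \<open>h\<close> against the unnormalised V_a of
  the unit mass at \<open>j\<close>, so identities between divided differences become identities
  between integrals of \<open>h\<close>.\<close>

definition secant_sum :: "ennreal \<Rightarrow> (nat \<Rightarrow> ennreal) \<Rightarrow> nat \<Rightarrow> ennreal" where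
  "secant_sum a h j = (\<Sum>m<j. a ^ (j - 1 - m) * h m)"

text \<open>The divided difference of the generating function f between \<open>a\<close> and 1: it
  is (1 - f(a)) / (1 - a) for \<open>a < 1\<close> and f'(1) for \<open>a = 1\<close>.\<close>

definition secant_mass :: "ennreal \<Rightarrow> nat pmf \<Rightarrow> ennreal" where
  "secant_mass a p = (\<integral>\<^sup>+ j. secant_sum a (\<lambda>_. 1) j \<partial>measure_pmf p)"

text \<open>The law \<open>V\<^sub>a(p)\<close>; a probability law only if \<open>secant_mass a p\<close> is neither 0 nor \<open>\<infinity>\<close>.\<close>

definition secant_pmf :: "ennreal \<Rightarrow> nat pmf \<Rightarrow> nat pmf" where
  "secant_pmf a p = embed_pmf (\<lambda>m. enn2real
     ((\<integral>\<^sup>+ j. (if m < j then a ^ (j - 1 - m) else 0) \<partial>measure_pmf p) / secant_mass a p))"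

lemma secant_sum_Suc: "secant_sum a h (Suc j) = a * secant_sum a h j + h j"
proof -
  have "(\<Sum>m<j. a ^ (j - m) * h m) = (\<Sum>m<j. a * (a ^ (j - 1 - m) * h m))"
    by (intro sum.cong refl) (auto simp: mult.assoc[symmetric] power_Suc[symmetric] Suc_diff_Suc)
  then show ?thesis by (simp add: secant_sum_def sum_distrib_left)
qed

lemma secant_sum_0: "secant_sum a h 0 = 0"
  by (simp add: secant_sum_def)

text \<open>Product rule: t^(x+y) - a^(x+y) = a^y (t^x - a^x) + t^x (t^y - a^y), where the factor
  t^x becomes the shift of \<open>h\<close> by \<open>x\<close>.\<close>

lemma secant_sum_add:
  "secant_sum a h (x + y) = a ^ y * secant_sum a h x + secant_sum a (\<lambda>m. h (x + m)) y"
  by (induction y) (simp_all add: secant_sum_0 secant_sum_Suc algebra_simps)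

lemma secant_sum_eq_nn_integral:
  "secant_sum a h j = (\<integral>\<^sup>+ m. (if m < j then a ^ (j - 1 - m) else 0) * h m \<partial>count_space UNIV)"
proof -
  have "(\<integral>\<^sup>+ m. (if m < j then a ^ (j - 1 - m) else 0) * h m \<partial>count_space UNIV)
     = (\<Sum>m<j. (if m < j then a ^ (j - 1 - m) else 0) * h m)"
    by (rule nn_integral_count_space') auto
  then show ?thesis by (simp add: secant_sum_def)
qed

lemma nn_integral_secant_weights:
  "(\<integral>\<^sup>+ m. (\<integral>\<^sup>+ j. (if m < j then a ^ (j - 1 - m) else 0) \<partial>measure_pmf p) * h m \<partial>count_space UNIV)
   = (\<integral>\<^sup>+ j. secant_sum a h j \<partial>measure_pmf p)"
proof -
  have "(\<integral>\<^sup>+ j. secant_sum a h j \<partial>measure_pmf p)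
     = (\<integral>\<^sup>+ j. (\<Sum>m. (if m < j then a ^ (j - 1 - m) else 0) * h m) \<partial>measure_pmf p)"
    by (simp add: secant_sum_eq_nn_integral nn_integral_count_space_nat)
  also have "\<dots> = (\<Sum>m. \<integral>\<^sup>+ j. (if m < j then a ^ (j - 1 - m) else 0) * h m \<partial>measure_pmf p)"
    by (rule nn_integral_suminf) simp
  also have "\<dots> = (\<integral>\<^sup>+ m. (\<integral>\<^sup>+ j. (if m < j then a ^ (j - 1 - m) else 0) \<partial>measure_pmf p) * h m
       \<partial>count_space UNIV)"
    by (simp add: nn_integral_count_space_nat nn_integral_multc)
  finally show ?thesis by simp
qed

lemma nn_integral_secant_pmf:
  assumes "secant_mass a p \<noteq> 0" "secant_mass a p \<noteq> \<infinity>"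
  shows "(\<integral>\<^sup>+ m. h m \<partial>measure_pmf (secant_pmf a p))
    = (\<integral>\<^sup>+ j. secant_sum a h j \<partial>measure_pmf p) / secant_mass a p"
proof -
  let ?w = "\<lambda>m. \<integral>\<^sup>+ j. (if m < j then a ^ (j - 1 - m) else 0) \<partial>measure_pmf p"
  let ?N = "secant_mass a p"
  have total: "(\<integral>\<^sup>+ m. ?w m \<partial>count_space UNIV) = ?N"
    using nn_integral_secant_weights[of p a "\<lambda>_. 1"] by (simp add: secant_mass_def)
  \<comment> \<open>\<open>secant_pmf\<close> is built with \<open>enn2real\<close>, which would
    send an infinite weight to 0; hence finiteness of every weight comes first.\<close>
  have fin: "?w m / ?N < \<infinity>" for m
  proof -
    have "?w m \<le> ?N" unfolding total[symmetric] nn_integral_count_space_nat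
      using sum_le_suminf[of "?w" "{m}"] by (simp add: summableI)
    then have "?w m < \<infinity>" using assms(2) by (metis infinity_ennreal_def le_less_trans top.not_eq_extremum)
    then show ?thesis using assms by (simp add: ennreal_divide_eq_top_iff less_top[symmetric])
  qed
  then have ee: "ennreal (enn2real (?w m / ?N)) = ?w m / ?N" for m by simp
  have "(\<integral>\<^sup>+ m. ?w m / ?N \<partial>count_space UNIV) = 1"
    using assms total by (simp add: nn_integral_divide ennreal_divide_self less_top)
  then have pmf: "pmf (secant_pmf a p) m = enn2real (?w m / ?N)" for m
    unfolding secant_pmf_def by (intro pmf_embed_pmf) (simp_all only: ee enn2real_nonneg)
  have "(\<integral>\<^sup>+ m. h m \<partial>measure_pmf (secant_pmf a p)) = (\<integral>\<^sup>+ m. ?w m * h m / ?N \<partial>count_space UNIV)"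
    unfolding nn_integral_measure_pmf[of "secant_pmf a p"] pmf ee
    by (intro nn_integral_cong) (simp only: divide_ennreal_def ac_simps)
  also have "\<dots> = (\<integral>\<^sup>+ m. ?w m * h m \<partial>count_space UNIV) / ?N"
    by (rule nn_integral_divide) simp
  finally show ?thesis unfolding nn_integral_secant_weights .
qed

text \<open>With g the generating function of \<open>q\<close>, g(t)^j - g(a)^j is g(t) - g(a) times
  the sum over m < j of g(a)^(j-1-m) g(t)^m. The innermost integral stands for (g(t) - g(a)) / (t -
  a), the one over \<open>iid_sum q m\<close> for g(t)^m.\<close>

lemma nn_integral_secant_sum_iid_sum:
  "(\<integral>\<^sup>+ s. secant_sum a h s \<partial>measure_pmf (iid_sum q j)) =
    secant_sum (egf q a) (\<lambda>m. \<integral>\<^sup>+ s. \<integral>\<^sup>+ x. secant_sum a (\<lambda>i. h (s + i)) x \<partial>measure_pmf q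
      \<partial>measure_pmf (iid_sum q m)) j"
proof (induction j)
  case 0
  then show ?case by (simp add: secant_sum_0)
next
  case (Suc j)
  have "(\<integral>\<^sup>+ s. secant_sum a h s \<partial>measure_pmf (iid_sum q (Suc j)))
     = egf q a * (\<integral>\<^sup>+ s. secant_sum a h s \<partial>measure_pmf (iid_sum q j)) +
       (\<integral>\<^sup>+ s. \<integral>\<^sup>+ x. secant_sum a (\<lambda>i. h (s + i)) x \<partial>measure_pmf q \<partial>measure_pmf (iid_sum q j))"
    by (simp add: secant_sum_add nn_integral_add nn_integral_multc nn_integral_cmult egf_def)
  then show ?case by (simp add: Suc secant_sum_Suc)
qed

lemma secant_sum_cmult: "secant_sum a (\<lambda>m. c * h m) j = c * secant_sum a h j"
  by (simp add: secant_sum_def sum_distrib_left ac_simps)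

text \<open>The chain rule at t = 1: for constant \<open>h\<close> the inner integrals reduce to the
  mass of \<open>q\<close>.\<close>

lemma secant_mass_compound: "secant_mass a (compound p q) = secant_mass (egf q a) p * secant_mass a q"
proof -
  have "secant_mass a (compound p q)
     = (\<integral>\<^sup>+ j. secant_sum (egf q a) (\<lambda>m. secant_mass a q * 1) j \<partial>measure_pmf p)"
    by (simp add: secant_mass_def[of a "compound p q"] nn_integral_compound
        nn_integral_secant_sum_iid_sum secant_mass_def[of a q])
  also have "\<dots> = secant_mass (egf q a) p * secant_mass a q"
    unfolding secant_sum_cmult by (simp add: nn_integral_cmult secant_mass_def mult.commute)
  finally show ?thesis .
qed

text \<open>The chain rule for divided differences.\<close>

lemma secant_pmf_compound:
  assumes "secant_mass (egf q a) p \<noteq> 0" "secant_mass (egf q a) p \<noteq> \<infinity>"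
    and "secant_mass a q \<noteq> 0" "secant_mass a q \<noteq> \<infinity>"
  shows "secant_pmf a (compound p q) =
    bind_pmf (secant_pmf (egf q a) p) (\<lambda>m. bind_pmf (iid_sum q m)
      (\<lambda>s. map_pmf (\<lambda>i. s + i) (secant_pmf a q)))"
    (is "_ = ?R")
proof -
  have nz: "secant_mass a (compound p q) \<noteq> 0" and nt: "secant_mass a (compound p q) \<noteq> \<infinity>"
    using assms by (auto simp: secant_mass_compound ennreal_mult_eq_top_iff)
  \<comment> \<open>Both laws are compared on all nonnegative functions; indicators of singletons
    then recover the point masses.\<close>
  have "(\<integral>\<^sup>+ x. h x \<partial>measure_pmf (secant_pmf a (compound p q))) = (\<integral>\<^sup>+ x. h x \<partial>measure_pmf ?R)"
    for h :: "nat \<Rightarrow> ennreal"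
  proof -
    define H where "H m = (\<integral>\<^sup>+ s. \<integral>\<^sup>+ x. secant_sum a (\<lambda>i. h (s + i)) x \<partial>measure_pmf q
      \<partial>measure_pmf (iid_sum q m))" for m
    have "(\<integral>\<^sup>+ x. h x \<partial>measure_pmf ?R) =
      (\<integral>\<^sup>+ m. H m / secant_mass a q \<partial>measure_pmf (secant_pmf (egf q a) p))"
      using assms(3,4) by (simp add: nn_integral_secant_pmf nn_integral_divide H_def)
    also have "\<dots> = (\<integral>\<^sup>+ m. H m \<partial>measure_pmf (secant_pmf (egf q a) p)) / secant_mass a q"
      by (simp add: nn_integral_divide)
    also have "\<dots> = (\<integral>\<^sup>+ j. secant_sum (egf q a) H j \<partial>measure_pmf p)
        / secant_mass (egf q a) p / secant_mass a q"
      using assms(1,2) by (simp add: nn_integral_secant_pmf)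
    also have "\<dots> = (\<integral>\<^sup>+ j. secant_sum (egf q a) H j \<partial>measure_pmf p) / secant_mass a (compound p q)"
      using assms unfolding secant_mass_compound divide_ennreal_def
      by (subst ennreal_inverse_mult) (auto simp: less_top mult.assoc)
    also have "\<dots> = (\<integral>\<^sup>+ x. h x \<partial>measure_pmf (secant_pmf a (compound p q)))"
      using nz nt by (simp add: nn_integral_secant_pmf nn_integral_compound H_def[abs_def]
          nn_integral_secant_sum_iid_sum)
    finally show ?thesis by simp
  qed
  note eq = this
  show ?thesis
  proof (rule pmf_eqI)
    fix i
    show "pmf (secant_pmf a (compound p q)) i = pmf ?R i"
      using eq[of "indicator {i}"] by (simp only: nn_integral_indicator sets_measure_pmf UNIV_I
        emeasure_pmf_single ennreal_inj pmf_nonneg nn_integral_indicator[of _ "measure_pmf _"]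
        sets_measure_pmf Pow_UNIV)
  qed
qed

section \<open>Moment estimates\<close>

definition gf :: "nat pmf \<Rightarrow> real \<Rightarrow> real" where
  "gf p a = (\<integral>j. a ^ j \<partial>measure_pmf p)"

text \<open>The slope (1 - f(a)) / (1 - a), written through geometric sums so that
  \<open>a = 1\<close> is included, where it is f'(1).\<close>

definition secant :: "nat pmf \<Rightarrow> real \<Rightarrow> real" where
  "secant p a = (\<integral>j. (\<Sum>i<j. a ^ i) \<partial>measure_pmf p)"

text \<open>\<open>mom1\<close>, \<open>mom2\<close> and \<open>mom3\<close> are f'(1), f''(1) and
  f'''(1). A Bochner integral is 0 when it diverges, so the estimates comparing them carry
  integrability hypotheses.\<close>

definition mom1 :: "nat pmf \<Rightarrow> real" where
  "mom1 p = (\<integral>j. real j \<partial>measure_pmf p)"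

definition mom2 :: "nat pmf \<Rightarrow> real" where
  "mom2 p = (\<integral>j. real j * (real j - 1) \<partial>measure_pmf p)"

definition mom3 :: "nat pmf \<Rightarrow> real" where
  "mom3 p = (\<integral>j. real j * (real j - 1) * (real j - 2) \<partial>measure_pmf p)"

lemma falling_nonneg:
  "0 \<le> real j * (real j - 1)" "0 \<le> real j * (real j - 1) * (real j - 2)"
proof -
  show 1: "0 \<le> real j * (real j - 1)" by (cases j) auto
  consider "j = 0" | "j = 1" | "j \<ge> 2" by linarith
  then show "0 \<le> real j * (real j - 1) * (real j - 2)"
    by cases (auto intro!: mult_nonneg_nonneg)
qed

lemma sum_index: "(\<Sum>i<j. real i) = real j * (real j - 1) / 2"
  by (induction j) (auto simp: field_simps)

lemma sum_index2: "(\<Sum>i<j. real i * (real i - 1)) = real j * (real j - 1) * (real j - 2) / 3"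
  by (induction j) (auto simp: field_simps)

text \<open>Both sides are the binomial coefficient of j over 3: a three-element subset of
  \<open>{..<j}\<close> with middle element m has m choices below and j - 1 - m above.\<close>

lemma sum_index_reverse:
  "(\<Sum>m<j. real m * real (j - 1 - m)) = real j * (real j - 1) * (real j - 2) / 6"
proof (induction j)
  case (Suc j)
  have "(\<Sum>m<j. real m * real (j - m)) = (\<Sum>m<j. real m * real (j - 1 - m) + real m)"
    by (intro sum.cong refl) (auto simp: of_nat_diff algebra_simps)
  then have "(\<Sum>m<Suc j. real m * real (Suc j - 1 - m))
      = (\<Sum>m<j. real m * real (j - 1 - m)) + (\<Sum>m<j. real m)"
    by (simp add: sum.distrib)
  then show ?case unfolding Suc.IH sum_index by (simp add: field_simps)
qed simp

text \<open>Multiplying the bound for \<open>i\<close> by \<open>1 - x\<close> gives the bound for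
  \<open>i + 1\<close> minus a nonnegative cubic term.\<close>

lemma power_le_bonferroni:
  fixes x :: real
  assumes "0 \<le> x" "x \<le> 1"
  shows "(1 - x) ^ i \<le> 1 - real i * x + real i * (real i - 1) / 2 * x\<^sup>2"
proof (induction i)
  case (Suc i)
  have "(1 - x) ^ Suc i \<le> (1 - x) * (1 - real i * x + real i * (real i - 1) / 2 * x\<^sup>2)"
    using Suc assms by (simp add: mult_left_mono)
  also have "\<dots> = 1 - real (Suc i) * x + real (Suc i) * (real (Suc i) - 1) / 2 * x\<^sup>2
      - real i * (real i - 1) / 2 * x ^ 3"
    by (simp add: field_simps power2_eq_square power3_eq_cube)
  also have "\<dots> \<le> 1 - real (Suc i) * x + real (Suc i) * (real (Suc i) - 1) / 2 * x\<^sup>2"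
    using assms falling_nonneg(1)[of i] by simp
  finally show ?case .
qed simp

lemma one_minus_power_le:
  fixes a :: real
  assumes "0 \<le> a"
  shows "1 - a ^ i \<le> real i * (1 - a)"
  using Bernoulli_inequality[of "a - 1" i] assms by (simp add: algebra_simps)

lemma integrable_power_le:
  assumes "integrable (measure_pmf p) (\<lambda>j. real j ^ n)" "m \<le> n"
  shows "integrable (measure_pmf p) (\<lambda>j. real j ^ m)"
proof (rule Bochner_Integration.integrable_bound)
  show "integrable (measure_pmf p) (\<lambda>j. 1 + real j ^ n)" using assms(1) by simp
  have "real j ^ m \<le> 1 + real j ^ n" for j
  proof (cases "j = 0")
    case True
    then show ?thesis by (cases m) auto
  next
    case False
    then have "real j ^ m \<le> real j ^ n" using assms(2) by (intro power_increasing) auto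
    then show ?thesis by simp
  qed
  then show "AE j in measure_pmf p. norm (real j ^ m) \<le> norm (1 + real j ^ n)" by simp
qed simp

lemma integrable_falling:
  assumes "integrable (measure_pmf p) (\<lambda>j. real j ^ 3)"
  shows "integrable (measure_pmf p) real"
    and "integrable (measure_pmf p) (\<lambda>j. real j * (real j - 1))"
    and "integrable (measure_pmf p) (\<lambda>j. real j * (real j - 1) * (real j - 2))"
proof -
  note i1 = integrable_power_le[OF assms, of 1, simplified]
    and i2 = integrable_power_le[OF assms, of 2, simplified]
  show "integrable (measure_pmf p) real" using i1 by simp
  have "integrable (measure_pmf p) (\<lambda>j. real j ^ 2 - real j)"
    by (intro Bochner_Integration.integrable_diff i1 i2)
  then show "integrable (measure_pmf p) (\<lambda>j. real j * (real j - 1))"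
    by (simp add: algebra_simps power2_eq_square)
  have "integrable (measure_pmf p) (\<lambda>j. real j ^ 3 - 3 * real j ^ 2 + 2 * real j)"
    using i1 i2 assms by simp
  then show "integrable (measure_pmf p) (\<lambda>j. real j * (real j - 1) * (real j - 2))"
    by (simp add: algebra_simps power2_eq_square power3_eq_cube)
qed

lemma geometric_sum_bounds:
  fixes a :: real
  assumes "0 \<le> a" "a \<le> 1"
  shows "0 \<le> (\<Sum>i<j. a ^ i)" "(\<Sum>i<j. a ^ i) \<le> real j"
    using assms sum_bounded_above[of "{..<j}" "\<lambda>i. a ^ i" 1]
    by (auto intro!: sum_nonneg power_le_one)

lemma integrable_power_pmf:
  fixes a :: real
  assumes "0 \<le> a" "a \<le> 1"
  shows "integrable (measure_pmf p) (\<lambda>j. a ^ j)"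
  using assms by (intro measure_pmf.integrable_const_bound[of _ 1]) (auto simp: power_le_one)

lemma integrable_geometric_sum:
  fixes a :: real
  assumes "integrable (measure_pmf p) real" "0 \<le> a" "a \<le> 1"
  shows "integrable (measure_pmf p) (\<lambda>j. \<Sum>i<j. a ^ i)"
  using geometric_sum_bounds[OF assms(2,3)]
  by (intro Bochner_Integration.integrable_bound[OF assms(1)]) auto

lemma gf_bounds:
  assumes "0 \<le> a" "a \<le> 1"
  shows "0 \<le> gf p a" "gf p a \<le> 1"
proof -
  show "0 \<le> gf p a" unfolding gf_def using assms by (intro Bochner_Integration.integral_nonneg) simp
  show "gf p a \<le> 1" unfolding gf_def
    using assms by (intro measure_pmf.integral_le_const integrable_power_pmf) (auto simp: power_le_one)
qed

lemma gf_mono: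
  assumes "0 \<le> a" "a \<le> b" "b \<le> 1"
  shows "gf p a \<le> gf p b"
  unfolding gf_def using assms
  by (intro integral_mono integrable_power_pmf) (auto intro: power_mono)

lemma gf_0: "gf p 0 = pmf p 0"
proof -
  have "gf p 0 = (\<integral>j. indicator {0} j \<partial>measure_pmf p)"
    unfolding gf_def by (intro Bochner_Integration.integral_cong) (auto simp: power_0_left)
  then show ?thesis by (simp add: pmf.rep_eq)
qed

lemma secant_eq:
  assumes "integrable (measure_pmf p) real" "0 \<le> a" "a \<le> 1"
  shows "(1 - a) * secant p a = 1 - gf p a"
proof -
  have "(1 - a) * secant p a = (\<integral>j. (1 - a) * (\<Sum>i<j. a ^ i) \<partial>measure_pmf p)"
    unfolding secant_def by (rule integral_mult_right_zero[symmetric])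
  also have "\<dots> = (\<integral>j. 1 - a ^ j \<partial>measure_pmf p)"
    by (simp add: one_diff_power_eq)
  also have "\<dots> = 1 - gf p a"
    using integrable_power_pmf[OF assms(2,3)]
    by (simp add: Bochner_Integration.integral_diff gf_def)
  finally show ?thesis .
qed

lemma secant_1: "secant p 1 = mom1 p"
  by (simp add: secant_def mom1_def)

lemma secant_mono:
  assumes "integrable (measure_pmf p) real" "0 \<le> a" "a \<le> b" "b \<le> 1"
  shows "secant p a \<le> secant p b"
  unfolding secant_def using assms
  by (intro integral_mono integrable_geometric_sum sum_mono power_mono) auto

lemma secant_pos:
  assumes "integrable (measure_pmf p) real" "0 \<le> a" "a \<le> 1" and "\<exists>j\<in>set_pmf p. j \<noteq> 0"
  shows "0 < secant p a"
proof -
  have nonneg: "AE j in measure_pmf p. 0 \<le> (\<Sum>i<j. a ^ i)"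
    using geometric_sum_bounds[OF assms(2,3)] by simp
  have "secant p a \<noteq> 0"
  proof
    assume "secant p a = 0"
    then have "AE j in measure_pmf p. (\<Sum>i<j. a ^ i) = 0"
      using integral_nonneg_eq_0_iff_AE[OF integrable_geometric_sum[OF assms(1-3)] nonneg]
      by (simp add: secant_def)
    moreover obtain j where j: "j \<in> set_pmf p" "j \<noteq> 0" using assms(4) by auto
    ultimately have "(\<Sum>i<j. a ^ i) = 0" by (auto simp: AE_measure_pmf_iff)
    \<comment> \<open>The summand \<open>i = 0\<close> equals 1 even for
      \<open>a = 0\<close>.\<close>
    then show False using j assms(2) sum_nonneg_eq_0_iff[of "{..<j}" "\<lambda>i. a ^ i"] by force
  qed
  moreover have "0 \<le> secant p a" unfolding secant_def using nonneg by (rule integral_nonneg_AE)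
  ultimately show ?thesis by simp
qed

text \<open>Bernoulli's inequality 1 - a^i <= i (1 - a), summed over i < j, bounds the loss of slope
  by its first-order Taylor term.\<close>

lemma secant_upper_defect:
  assumes "integrable (measure_pmf p) (\<lambda>j. real j ^ 3)" "0 \<le> a" "a \<le> 1"
  shows "mom1 p - secant p a \<le> (1 - a) * mom2 p / 2"
proof -
  note int = integrable_falling[OF assms(1)]
  have le: "real j - (\<Sum>i<j. a ^ i) \<le> (1 - a) / 2 * (real j * (real j - 1))" for j
  proof -
    have "real j - (\<Sum>i<j. a ^ i) = (\<Sum>i<j. 1 - a ^ i)" by (simp add: sum_subtractf)
    also have "\<dots> \<le> (\<Sum>i<j. real i * (1 - a))"
      by (intro sum_mono one_minus_power_le assms)
    finally show ?thesis by (simp add: sum_distrib_right[symmetric] sum_index mult.commute)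
  qed
  have "mom1 p - secant p a = (\<integral>j. real j - (\<Sum>i<j. a ^ i) \<partial>measure_pmf p)"
    unfolding mom1_def secant_def
    by (intro Bochner_Integration.integral_diff[symmetric] int integrable_geometric_sum assms)
  also have "\<dots> \<le> (\<integral>j. (1 - a) / 2 * (real j * (real j - 1)) \<partial>measure_pmf p)"
    by (intro integral_mono le Bochner_Integration.integrable_diff int integrable_geometric_sum
        assms integrable_mult_right)
  finally show ?thesis by (simp add: mom2_def)
qed

text \<open>The Bonferroni inequality bounds 1 - a^i from below to second order in 1 - a; summing
  over i < j turns its two terms into the second and third factorial moments.\<close>

lemma secant_lower_defect:
  assumes "integrable (measure_pmf p) (\<lambda>j. real j ^ 3)" "0 \<le> a" "a \<le> 1"
  shows "(1 - a) * mom2 p / 2 - (1 - a)\<^sup>2 * mom3 p / 6 \<le> mom1 p - secant p a"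
proof -
  note int = integrable_falling[OF assms(1)]
  have le: "(1 - a) / 2 * (real j * (real j - 1)) - (1 - a)\<^sup>2 / 6 * (real j * (real j - 1) * (real j - 2))
      \<le> real j - (\<Sum>i<j. a ^ i)" for j
  proof -
    have "(1 - a) / 2 * (real j * (real j - 1)) - (1 - a)\<^sup>2 / 6 * (real j * (real j - 1) * (real j - 2))
       = (\<Sum>i<j. (1 - a) * real i - (1 - a)\<^sup>2 / 2 * (real i * (real i - 1)))"
      unfolding sum_subtractf sum_distrib_left[symmetric] sum_index sum_index2
      by (simp add: field_simps)
    also have "\<dots> \<le> (\<Sum>i<j. 1 - a ^ i)"
      using power_le_bonferroni[of "1 - a"] assms
      by (intro sum_mono) (auto simp: algebra_simps)
    finally show ?thesis by (simp add: sum_subtractf)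
  qed
  have "(1 - a) * mom2 p / 2 - (1 - a)\<^sup>2 * mom3 p / 6 = (\<integral>j. (1 - a) / 2 * (real j * (real j - 1))
      - (1 - a)\<^sup>2 / 6 * (real j * (real j - 1) * (real j - 2)) \<partial>measure_pmf p)"
    using int by (simp add: Bochner_Integration.integral_diff mom2_def mom3_def)
  also have "\<dots> \<le> (\<integral>j. real j - (\<Sum>i<j. a ^ i) \<partial>measure_pmf p)"
    by (intro integral_mono le Bochner_Integration.integrable_diff int integrable_geometric_sum
        assms integrable_mult_right)
  also have "\<dots> = mom1 p - secant p a"
    unfolding mom1_def secant_def
    by (intro Bochner_Integration.integral_diff int integrable_geometric_sum assms)
  finally show ?thesis .
qed

section \<open>Cauchy--Schwarz, reciprocal slopes and the shape function\<close>

lemma mom2_nonneg: "0 \<le> mom2 p"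
  unfolding mom2_def by (intro Bochner_Integration.integral_nonneg falling_nonneg)

lemma mom3_nonneg: "0 \<le> mom3 p"
  unfolding mom3_def by (intro Bochner_Integration.integral_nonneg falling_nonneg)

lemma mom1_pos:
  assumes "integrable (measure_pmf p) real" "\<exists>j\<in>set_pmf p. j \<noteq> 0"
  shows "0 < mom1 p"
  using secant_pos[OF assms(1) _ _ assms(2), of 1] by (simp add: secant_1)

text \<open>Cauchy--Schwarz for \<open>j (j - 1) = \<surd>j \<cdot> \<surd>j (j - 1)\<close>.\<close>

lemma mom2_power2_le:
  assumes int3: "integrable (measure_pmf p) (\<lambda>j. real j ^ 3)" and "\<exists>j\<in>set_pmf p. j \<noteq> 0"
  shows "(mom2 p)\<^sup>2 \<le> mom1 p * (mom3 p + mom2 p)"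
proof -
  note int = integrable_falling[OF int3]
  have pos: "0 < mom1 p" using int assms by (intro mom1_pos)
  \<comment> \<open>E[j (j - 1 - x)^2] is minimal at x = \<open>mom2 p / mom1 p\<close>; this is
    that value cleared of denominators. Its expansion uses j (j-1)^2 = j (j-1) (j-2) + j
    (j-1).\<close>
  have "0 \<le> (\<integral>j. real j * (mom1 p * (real j - 1) - mom2 p)\<^sup>2 \<partial>measure_pmf p)"
    by (intro Bochner_Integration.integral_nonneg) simp
  also have "\<dots> = (\<integral>j. (mom1 p)\<^sup>2 * (real j * (real j - 1) * (real j - 2) + real j * (real j - 1))
      - 2 * mom1 p * mom2 p * (real j * (real j - 1)) + (mom2 p)\<^sup>2 * real j \<partial>measure_pmf p)"
    by (intro Bochner_Integration.integral_cong refl)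
      (simp add: algebra_simps power2_eq_square power3_eq_cube)
  also have "\<dots> = (mom1 p)\<^sup>2 * (mom3 p + mom2 p) - 2 * mom1 p * mom2 p * mom2 p + (mom2 p)\<^sup>2 * mom1 p"
    using int by (simp add: mom1_def[symmetric] mom2_def[symmetric] mom3_def[symmetric])
  also have "\<dots> = mom1 p * (mom1 p * (mom3 p + mom2 p) - (mom2 p)\<^sup>2)"
    by (simp add: algebra_simps power2_eq_square)
  finally show ?thesis using pos by (simp add: zero_le_mult_iff)
qed

text \<open>While \<open>(1 - a) * mom2 p \<le> mom1 p\<close>, the linear defect bound keeps the
  slope above half the mean. For smaller \<open>a\<close>, monotonicity of the generating function
  carries the bound over from the boundary point of that range.\<close>

lemma inverse_secant_le:
  assumes int3: "integrable (measure_pmf p) (\<lambda>j. real j ^ 3)" and nz: "\<exists>j\<in>set_pmf p. j \<noteq> 0"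
    and a: "0 \<le> a" "a \<le> 1"
  shows "1 / secant p a - 1 / mom1 p \<le> 2 * (1 - a) * mom2 p / (mom1 p)\<^sup>2"
proof -
  note int = integrable_falling[OF int3]
  have m: "0 < mom1 p" using int nz by (intro mom1_pos)
  have N: "0 < secant p a" using int nz a by (intro secant_pos)
  have lower: "mom1 p / 2 \<le> secant p b" if "0 \<le> b" "b \<le> 1" "(1 - b) * mom2 p \<le> mom1 p" for b
    using secant_upper_defect[OF int3 that(1,2)] that(3) by simp
  show ?thesis
  proof (cases "(1 - a) * mom2 p \<le> mom1 p")
    case True
    have "1 / secant p a - 1 / mom1 p = (mom1 p - secant p a) / (secant p a * mom1 p)"
      using m N by (simp add: field_simps)
    also have "\<dots> \<le> ((1 - a) * mom2 p / 2) / ((mom1 p / 2) * mom1 p)"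
      using secant_upper_defect[OF int3 a] lower[OF a True] m N a mom2_nonneg[of p]
      by (intro frac_le mult_right_mono) (auto intro!: mult_nonneg_nonneg)
    also have "\<dots> = (1 - a) * mom2 p / (mom1 p)\<^sup>2"
      by (simp add: power2_eq_square)
    also have "\<dots> \<le> 2 * (1 - a) * mom2 p / (mom1 p)\<^sup>2"
      using mult_nonneg_nonneg[of "1 - a" "mom2 p"] a mom2_nonneg[of p]
      by (intro divide_right_mono) (auto simp: algebra_simps)
    finally show ?thesis .
  next
    case False
    then have m2: "0 < mom2 p" using m mom2_nonneg[of p] by (cases "mom2 p = 0") auto
    \<comment> \<open>The boundary point, where \<open>(1 - b) * mom2 p = mom1 p\<close>. In this
      case it lies to the right of \<open>a\<close>, and \<open>mom1 p \<le> mom2 p\<close> makes it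
      nonnegative.\<close>
    define b where "b = 1 - mom1 p / mom2 p"
    have le: "mom1 p \<le> mom2 p"
      using mult_right_mono[of "1 - a" 1 "mom2 p"] False a m2 by linarith
    have b: "a \<le> b" "b \<le> 1" "0 \<le> b" "(1 - b) * mom2 p = mom1 p"
      using False m m2 a le by (auto simp: b_def field_simps)
    have "a < 1" using False m a by (cases "a = 1") auto
    have "(1 - b) * (mom1 p / 2) \<le> (1 - b) * secant p b"
      using b lower[of b] by (intro mult_left_mono) auto
    also have "\<dots> \<le> (1 - a) * secant p a"
      using secant_eq[OF int(1), of a] secant_eq[OF int(1), of b] gf_mono[of a b p] a b by simp
    finally have "mom1 p * mom1 p \<le> 2 * (1 - a) * mom2 p * secant p a"
      using m2 by (simp add: b_def field_simps)
    then have "1 / secant p a \<le> 2 * (1 - a) * mom2 p / (mom1 p)\<^sup>2"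
      using m N by (simp add: field_simps power2_eq_square)
    then show ?thesis using m by (smt (verit) divide_pos_pos)
  qed
qed

text \<open>1 / (1 - f(a)) - 1 / (f'(1) (1 - a)) is Kersting's shape function; it equals the slope
  defect divided by \<open>mom1 p * (1 - gf p a)\<close>. Close to 1 the defect is linear in 1 - a;
  further away it is at least its value at \<open>1 - x0\<close>.\<close>

lemma shape_function_ge:
  assumes int3: "integrable (measure_pmf p) (\<lambda>j. real j ^ 3)" and nz: "\<exists>j\<in>set_pmf p. j \<noteq> 0"
    and a: "0 \<le> a" "a < 1" and c: "1 \<le> c" "mom3 p \<le> c * mom2 p * (1 + mom1 p)"
  shows "1 / (mom1 p * (1 - a)) + mom2 p / (mom1 p)\<^sup>2 / (6 * c) \<le> 1 / (1 - gf p a)"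
proof -
  note int = integrable_falling[OF int3]
  have m: "0 < mom1 p" using int nz by (intro mom1_pos)
  have N: "0 < secant p a" using int nz a by (intro secant_pos) auto
  have u: "1 - gf p a = (1 - a) * secant p a" using secant_eq[OF int(1), of a] a by simp
  have upos: "0 < 1 - gf p a" unfolding u using N a by simp
  have Nle: "secant p a \<le> mom1 p" using secant_mono[OF int(1), of a 1] a by (simp add: secant_1)
  \<comment> \<open>Chosen so that the cubic bound gives \<open>x * mom3 p \<le> mom2 p\<close> for
    \<open>x \<le> x0\<close>: the second-order correction then costs at most a third of the leading
    term \<open>x * mom2 p / 2\<close>.\<close>
  define x0 where "x0 = 1 / (c * (1 + mom1 p))"
  have x0: "0 < x0" "x0 \<le> 1" using m c(1) by (auto simp: x0_def intro!: mult_ge1_I)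
  have small: "x * mom2 p / 3 \<le> mom1 p - secant p (1 - x)" if "0 \<le> x" "x \<le> x0" for x
  proof -
    have "x * mom3 p \<le> x0 * mom3 p" using that mom3_nonneg[of p] by (intro mult_right_mono) auto
    also have "\<dots> \<le> x0 * (c * mom2 p * (1 + mom1 p))" using x0 c(2) by (intro mult_left_mono) auto
    also have "\<dots> = mom2 p" using m c(1) by (simp add: x0_def)
    finally have "x * (x * mom3 p) \<le> x * mom2 p" using that(1) by (rule mult_left_mono)
    then show ?thesis using secant_lower_defect[OF int3, of "1 - x"] that x0
      by (simp add: power2_eq_square algebra_simps)
  qed
  have "mom2 p / (6 * c * (mom1 p)\<^sup>2) \<le> (mom1 p - secant p a) / (mom1 p * (1 - gf p a))"
  proof (cases "1 - a \<le> x0")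
    case True
    have "mom2 p / (6 * c * (mom1 p)\<^sup>2) \<le> mom2 p / (3 * (mom1 p)\<^sup>2)"
      using c(1) m mom2_nonneg[of p] by (intro divide_left_mono mult_right_mono) auto
    also have "\<dots> = ((1 - a) * mom2 p / 3) / (mom1 p * ((1 - a) * mom1 p))"
      using a m by (simp add: power2_eq_square)
    also have "\<dots> \<le> (mom1 p - secant p a) / (mom1 p * (1 - gf p a))"
      using small[of "1 - a"] True a m N Nle u upos mom2_nonneg[of p]
      by (intro frac_le mult_left_mono) (auto simp: u)
    finally show ?thesis .
  next
    case False
    \<comment> \<open>1 - f(a) is at most \<open>mom1 p\<close> and at most 1; together these absorb
      the factor \<open>1 + mom1 p\<close> contained in \<open>x0\<close>.\<close>
    have "1 - gf p a \<le> 1 * mom1 p" unfolding u using Nle N a by (intro mult_mono) auto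
    moreover have "1 - gf p a \<le> 1" using gf_bounds[of a p] a by simp
    then have "mom1 p * (1 - gf p a) \<le> mom1 p * 1" using m by (intro mult_left_mono) auto
    ultimately have le: "(1 + mom1 p) * (1 - gf p a) \<le> 2 * mom1 p" by (simp add: algebra_simps)
    have "mom2 p / (6 * c * (mom1 p)\<^sup>2) = (mom2 p / 3) / (mom1 p * (c * (2 * mom1 p)))"
      by (simp add: power2_eq_square)
    also have "\<dots> \<le> (mom2 p / 3) / (mom1 p * (c * ((1 + mom1 p) * (1 - gf p a))))"
      using le c(1) m upos mom2_nonneg[of p] by (intro divide_left_mono mult_left_mono) auto
    also have "\<dots> = (x0 * mom2 p / 3) / (mom1 p * (1 - gf p a))"
      by (simp add: x0_def)
    also have "\<dots> \<le> (mom1 p - secant p a) / (mom1 p * (1 - gf p a))"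
    proof (rule divide_right_mono)
      have "secant p a \<le> secant p (1 - x0)"
        using secant_mono[OF int(1), of a "1 - x0"] a x0 False by simp
      then show "x0 * mom2 p / 3 \<le> mom1 p - secant p a" using small[of x0] x0 by simp
    qed (use m upos in simp)
    finally show ?thesis .
  qed
  also have "\<dots> = 1 / (1 - gf p a) - 1 / (mom1 p * (1 - a))"
  proof -
    have "(M - S) / (M * (x * S)) = 1 / (x * S) - 1 / (M * x)"
      if "0 < M" "0 < S" "0 < x" for M S x :: real
      using that by (simp add: field_simps)
    from this[of "mom1 p" "secant p a" "1 - a"] show ?thesis using m a N unfolding u by simp
  qed
  finally show ?thesis by (simp add: field_simps)
qed

section \<open>Real expectations under secant laws\<close>

lemma sum_powers_reverse:
  fixes a :: "'b::comm_semiring_1"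
  shows "(\<Sum>m<j. a ^ (j - 1 - m)) = (\<Sum>i<j. a ^ i)"
  using sum.nat_diff_reindex[of "\<lambda>i. a ^ i" j] by simp

lemma secant_mass_eq:
  assumes "integrable (measure_pmf p) real" "0 \<le> a" "a \<le> 1"
  shows "secant_mass (ennreal a) p = ennreal (secant p a)"
proof -
  have "secant_sum (ennreal a) (\<lambda>_. 1) j = ennreal (\<Sum>i<j. a ^ i)" for j
    unfolding secant_sum_def using assms
    by (simp add: sum.nat_diff_reindex[of "\<lambda>i. a ^ i"] ennreal_power sum_ennreal)
  then have "secant_mass (ennreal a) p = (\<integral>\<^sup>+ j. ennreal (\<Sum>i<j. a ^ i) \<partial>measure_pmf p)"
    unfolding secant_mass_def by (intro nn_integral_cong) simp
  also have "\<dots> = ennreal (secant p a)"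
    unfolding secant_def
    using integrable_geometric_sum[OF assms] geometric_sum_bounds[OF assms(2,3)]
    by (intro nn_integral_eq_integral) auto
  finally show ?thesis .
qed

lemma secant_mass_finite_pos:
  assumes "integrable (measure_pmf p) real" "\<exists>j\<in>set_pmf p. j \<noteq> 0" "0 \<le> a" "a \<le> 1"
  shows "secant_mass (ennreal a) p \<noteq> 0" "secant_mass (ennreal a) p \<noteq> \<infinity>"
  using secant_pos[OF assms(1,3,4,2)] by (simp_all add: secant_mass_eq[OF assms(1,3,4)])

lemma egf_eq_gf:
  assumes "0 \<le> a" "a \<le> 1"
  shows "egf p (ennreal a) = ennreal (gf p a)"
  unfolding egf_def gf_def using assms
  by (subst nn_integral_eq_integral[symmetric])
     (auto intro!: integrable_power_pmf nn_integral_cong simp: ennreal_power)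

lemma weighted_sum_bound:
  fixes h :: "nat \<Rightarrow> real" and a :: real
  assumes "\<And>m. \<bar>h m\<bar> \<le> B" "0 \<le> a" "a \<le> 1"
  shows "\<bar>\<Sum>m<j. a ^ (j - 1 - m) * h m\<bar> \<le> B * real j"
proof -
  have "\<bar>a ^ (j - 1 - m) * h m\<bar> \<le> 1 * B" for m
    unfolding abs_mult using assms by (intro mult_mono) (auto simp: power_le_one)
  then have "\<bar>\<Sum>m<j. a ^ (j - 1 - m) * h m\<bar> \<le> (\<Sum>m<j. B)"
    by (intro order_trans[OF sum_abs] sum_mono) simp
  then show ?thesis by (simp add: mult.commute)
qed

lemma integrable_weighted_sum:
  fixes h :: "nat \<Rightarrow> real"
  assumes "integrable (measure_pmf p) real" "\<And>m. \<bar>h m\<bar> \<le> B" "0 \<le> a" "a \<le> 1"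
  shows "integrable (measure_pmf p) (\<lambda>j. \<Sum>m<j. a ^ (j - 1 - m) * h m)"
proof (rule Bochner_Integration.integrable_bound)
  show "integrable (measure_pmf p) (\<lambda>j. B * real j)" using assms(1) by simp
  show "AE j in measure_pmf p. norm (\<Sum>m<j. a ^ (j - 1 - m) * h m) \<le> norm (B * real j)"
    using weighted_sum_bound[of h B a] assms(2-4)
    by (intro AE_pmfI) (smt (verit) real_norm_def)
qed simp

lemma integrable_bounded_pmf:
  fixes h :: "'b \<Rightarrow> real"
  assumes "\<And>m. \<bar>h m\<bar> \<le> B"
  shows "integrable (measure_pmf p) h"
  using assms by (intro measure_pmf.integrable_const_bound[of _ B]) auto

lemma expectation_secant_pmf:
  fixes h :: "nat \<Rightarrow> real"
  assumes int: "integrable (measure_pmf p) real" and nz: "\<exists>j\<in>set_pmf p. j \<noteq> 0"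
    and a: "0 \<le> a" "a \<le> 1" and h: "\<And>m. \<bar>h m\<bar> \<le> B"
  shows "(\<integral>m. h m \<partial>measure_pmf (secant_pmf (ennreal a) p)) =
    (\<integral>j. (\<Sum>m<j. a ^ (j - 1 - m) * h m) \<partial>measure_pmf p) / secant p a"
proof -
  note N = secant_pos[OF int a nz]
  have nonneg: "(\<integral>m. g m \<partial>measure_pmf (secant_pmf (ennreal a) p)) =
    (\<integral>j. (\<Sum>m<j. a ^ (j - 1 - m) * g m) \<partial>measure_pmf p) / secant p a"
    if g: "\<And>m. \<bar>g m\<bar> \<le> G" "\<And>m. 0 \<le> g m" for g :: "nat \<Rightarrow> real" and G
  proof -
    have ss: "secant_sum (ennreal a) (\<lambda>m. ennreal (g m)) j
        = ennreal (\<Sum>m<j. a ^ (j - 1 - m) * g m)" for j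
      unfolding secant_sum_def using a g(2)
      by (simp add: ennreal_power sum_ennreal ennreal_mult''[symmetric])
    have nn: "0 \<le> (\<Sum>m<j. a ^ (j - 1 - m) * g m)" for j
      using a g(2) by (intro sum_nonneg) auto
    have "ennreal (\<integral>m. g m \<partial>measure_pmf (secant_pmf (ennreal a) p))
       = (\<integral>\<^sup>+ m. ennreal (g m) \<partial>measure_pmf (secant_pmf (ennreal a) p))"
      using g by (intro nn_integral_eq_integral[symmetric] integrable_bounded_pmf[of g G]) auto
    also have "\<dots> = (\<integral>\<^sup>+ j. ennreal (\<Sum>m<j. a ^ (j - 1 - m) * g m) \<partial>measure_pmf p) / ennreal (secant p a)"
      using nn_integral_secant_pmf[OF secant_mass_finite_pos[OF int nz a]]
      by (simp only: ss secant_mass_eq[OF int a])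
    also have "\<dots> = ennreal (\<integral>j. (\<Sum>m<j. a ^ (j - 1 - m) * g m) \<partial>measure_pmf p) / ennreal (secant p a)"
      using nn by (subst nn_integral_eq_integral[OF integrable_weighted_sum[OF int g(1) a]]) auto
    also have "\<dots> = ennreal ((\<integral>j. (\<Sum>m<j. a ^ (j - 1 - m) * g m) \<partial>measure_pmf p) / secant p a)"
      using N nn by (intro divide_ennreal Bochner_Integration.integral_nonneg) auto
    finally show ?thesis
      using N nn g(2) by (subst (asm) ennreal_inj)
        (auto intro!: Bochner_Integration.integral_nonneg divide_nonneg_pos)
  qed
  have B: "0 \<le> B" using h[of 0] by simp
  \<comment> \<open>Adding the bound \<open>B\<close> makes the function nonnegative. The shift
    contributes \<open>B\<close> on both sides, since the weights have total
    \<open>secant p a\<close>.\<close>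
  have "(\<integral>m. h m + B \<partial>measure_pmf (secant_pmf (ennreal a) p)) =
    (\<integral>j. (\<Sum>m<j. a ^ (j - 1 - m) * (h m + B)) \<partial>measure_pmf p) / secant p a"
  proof (rule nonneg)
    fix m show "\<bar>h m + B\<bar> \<le> 2 * B" "0 \<le> h m + B" using h[of m] by auto
  qed
  also have "(\<integral>j. (\<Sum>m<j. a ^ (j - 1 - m) * (h m + B)) \<partial>measure_pmf p)
     = (\<integral>j. (\<Sum>m<j. a ^ (j - 1 - m) * h m) + B * (\<Sum>i<j. a ^ i) \<partial>measure_pmf p)"
    by (simp add: sum.distrib sum_distrib_left sum_powers_reverse[symmetric] algebra_simps)
  also have "\<dots> = (\<integral>j. (\<Sum>m<j. a ^ (j - 1 - m) * h m) \<partial>measure_pmf p) + B * secant p a"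
    unfolding secant_def
    using integrable_weighted_sum[OF int h a] integrable_geometric_sum[OF int a] by simp
  finally show ?thesis
    using N integrable_bounded_pmf[of h B] h by (simp add: add_divide_distrib)
qed

text \<open>The normalised weights of the two laws are compared term by term. The change of
  normalisation costs \<open>D\<close>, controlled by \<open>inverse_secant_le\<close> and paired
  with \<open>mom2\<close>; the change of the powers of \<open>a\<close> is paired with
  \<open>mom3\<close>. The cubic bound makes both of order
  \<open>(1 - a) * mom2 p / mom1 p * (1 + mom1 p)\<close>.\<close>

lemma secant_pmf_close:
  fixes h :: "nat \<Rightarrow> real"
  assumes int3: "integrable (measure_pmf p) (\<lambda>j. real j ^ 3)" and nz: "\<exists>j\<in>set_pmf p. j \<noteq> 0"
    and a: "0 \<le> a" "a \<le> 1" and c: "0 \<le> c" "mom3 p \<le> c * mom2 p * (1 + mom1 p)"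
    and h: "\<And>m. \<bar>h m\<bar> \<le> B" and L: "\<And>m. \<bar>h m - h 0\<bar> \<le> L * real m"
  shows "\<bar>(\<integral>m. h m \<partial>measure_pmf (secant_pmf (ennreal a) p))
      - (\<integral>m. h m \<partial>measure_pmf (secant_pmf 1 p))\<bar>
    \<le> L * (2 * (c + 1) * (1 - a) * (mom2 p / mom1 p * (1 + mom1 p)))"
proof -
  note int = integrable_falling[OF int3]
  have m: "0 < mom1 p" using int nz by (intro mom1_pos)
  have N: "0 < secant p a" using int nz a by (intro secant_pos)
  \<comment> \<open>Centring at \<open>h 0\<close> leaves the difference of two expectations
    unchanged and gives \<open>\<bar>g m\<bar> \<le> L * real m\<close>; this factor
    \<open>m\<close> raises the order of the moments that appear.\<close>
  define g where "g m = h m - h 0" for m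
  have g: "\<bar>g m\<bar> \<le> 2 * B" for m using h[of m] h[of 0] by (auto simp: g_def)
  have L0: "0 \<le> L" using L[of 1] by simp
  define D where "D = 1 / secant p a - 1 / mom1 p"
  have D0: "0 \<le> D" using secant_mono[OF int(1), of a 1] a m N
    by (simp add: D_def secant_1 field_simps)
  let ?W = "\<lambda>a j. \<Sum>m<j. a ^ (j - 1 - m) * g m"
  have E: "(\<integral>m. h m \<partial>measure_pmf (secant_pmf (ennreal b) p)) - h 0 =
    (\<integral>j. ?W b j \<partial>measure_pmf p) / secant p b" if b: "0 \<le> b" "b \<le> 1" for b
    using expectation_secant_pmf[where h = g, OF int(1) nz b g] integrable_bounded_pmf[of h B] h
    by (simp add: g_def)
  have "\<bar>(\<integral>m. h m \<partial>measure_pmf (secant_pmf (ennreal a) p))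
      - (\<integral>m. h m \<partial>measure_pmf (secant_pmf 1 p))\<bar>
    = \<bar>(\<integral>j. ?W a j / secant p a - ?W 1 j / mom1 p \<partial>measure_pmf p)\<bar>"
    using E[OF a] E[of 1] integrable_weighted_sum[OF int(1) g a]
      integrable_weighted_sum[OF int(1) g, of 1] by (simp add: secant_1)
  also have "\<dots> \<le> (\<integral>j. \<bar>?W a j / secant p a - ?W 1 j / mom1 p\<bar> \<partial>measure_pmf p)"
    by (rule integral_abs_bound)
  also have "\<dots> \<le> (\<integral>j. L * (D / 2 * (real j * (real j - 1))
      + (1 - a) / mom1 p / 6 * (real j * (real j - 1) * (real j - 2))) \<partial>measure_pmf p)"
  proof (rule integral_mono)
    show "integrable (measure_pmf p) (\<lambda>j. \<bar>?W a j / secant p a - ?W 1 j / mom1 p\<bar>)"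
      using integrable_weighted_sum[OF int(1) g a] integrable_weighted_sum[OF int(1) g, of 1] by simp
    show "integrable (measure_pmf p) (\<lambda>j. L * (D / 2 * (real j * (real j - 1))
      + (1 - a) / mom1 p / 6 * (real j * (real j - 1) * (real j - 2))))"
      using int by simp
    fix j
    have split: "L * D * (X / 2) + L * R * (Y / 6) = L * (D / 2 * X + R / 6 * Y)" for X R Y
      by (simp add: field_simps)
    have bnd: "\<bar>a ^ i / secant p a - 1 / mom1 p\<bar> \<le> D + real i * ((1 - a) / mom1 p)" for i
    proof -
      have ai: "0 \<le> a ^ i" "a ^ i \<le> 1" using a by (auto simp: power_le_one)
      \<comment> \<open>Separates the error of the normalisation from the error of the
        power.\<close>
      have "a ^ i / secant p a - 1 / mom1 p = a ^ i * D - (1 - a ^ i) / mom1 p"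
        by (simp add: D_def algebra_simps diff_divide_distrib)
      moreover have "(1 - a ^ i) / mom1 p \<le> real i * ((1 - a) / mom1 p)"
        using divide_right_mono[OF one_minus_power_le[OF a(1), of i], of "mom1 p"] m by simp
      moreover have "0 \<le> a ^ i * D" "a ^ i * D \<le> 1 * D" "0 \<le> (1 - a ^ i) / mom1 p"
        using ai D0 m by (auto intro!: mult_left_le_one_le)
      ultimately show ?thesis by (simp add: abs_le_iff)
    qed
    have "?W a j / secant p a - ?W 1 j / mom1 p
       = (\<Sum>m<j. (a ^ (j - 1 - m) / secant p a - 1 / mom1 p) * g m)"
      by (simp add: sum_divide_distrib sum_subtractf[symmetric] algebra_simps)
    also have "\<bar>\<dots>\<bar> \<le> (\<Sum>m<j. \<bar>(a ^ (j - 1 - m) / secant p a - 1 / mom1 p) * g m\<bar>)"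
      by (rule sum_abs)
    also have "\<dots> \<le> (\<Sum>m<j. (D + real (j - 1 - m) * ((1 - a) / mom1 p)) * (L * real m))"
      unfolding abs_mult using L a m D0
      by (intro sum_mono mult_mono bnd) (auto simp: g_def)
    also have "\<dots> = (\<Sum>m<j. L * D * real m + L * ((1 - a) / mom1 p) * (real m * real (j - 1 - m)))"
      by (intro sum.cong refl) (simp only: algebra_simps)
    also have "\<dots> = L * D * (real j * (real j - 1) / 2)
        + L * ((1 - a) / mom1 p) * (real j * (real j - 1) * (real j - 2) / 6)"
      unfolding sum.distrib sum_distrib_left[symmetric] sum_index sum_index_reverse ..
    finally show "\<bar>?W a j / secant p a - ?W 1 j / mom1 p\<bar> \<le> L * (D / 2 * (real j * (real j - 1))
      + (1 - a) / mom1 p / 6 * (real j * (real j - 1) * (real j - 2)))"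
      using split[of "real j * (real j - 1)" "(1 - a) / mom1 p" "real j * (real j - 1) * (real j - 2)"]
      by simp
  qed
  also have "\<dots> = L * (D / 2 * mom2 p + (1 - a) / mom1 p / 6 * mom3 p)"
    using int by (simp add: mom2_def mom3_def)
  also have "\<dots> \<le> L * (2 * (c + 1) * (1 - a) * (mom2 p / mom1 p * (1 + mom1 p)))"
  proof (rule mult_left_mono[OF _ L0])
    let ?T = "mom2 p / mom1 p * (1 + mom1 p)"
    have T: "0 \<le> ?T" using m mom2_nonneg[of p] by simp
    \<comment> \<open>\<open>D * mom2 p\<close> is quadratic in \<open>mom2 p\<close>;
      Cauchy--Schwarz and the cubic bound replace the square by a term linear in
      \<open>mom2 p\<close>.\<close>
    have "(mom2 p)\<^sup>2 \<le> mom1 p * (mom3 p + mom2 p)" by (rule mom2_power2_le[OF int3 nz])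
    also have "mom3 p + mom2 p \<le> (c + 1) * (mom2 p * (1 + mom1 p))"
    proof -
      have "0 \<le> mom2 p * mom1 p" using mom2_nonneg[of p] m by simp
      then show ?thesis using c(2) by (simp add: algebra_simps)
    qed
    finally have "(mom2 p)\<^sup>2 \<le> mom1 p * ((c + 1) * (mom2 p * (1 + mom1 p)))" using m by simp
    then have sq: "(mom2 p / mom1 p)\<^sup>2 \<le> (c + 1) * ?T"
      using m by (simp add: field_simps power2_eq_square)
    have "D / 2 * mom2 p \<le> 2 * (1 - a) * mom2 p / (mom1 p)\<^sup>2 / 2 * mom2 p"
      using inverse_secant_le[OF int3 nz a] mom2_nonneg[of p] unfolding D_def
      by (intro mult_right_mono divide_right_mono) auto
    also have "\<dots> = (1 - a) * (mom2 p / mom1 p)\<^sup>2"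
    proof -
      have "2 * x * M / K\<^sup>2 / 2 * M = x * (M / K)\<^sup>2" for x M K :: real
        by (simp add: power2_eq_square)
      then show ?thesis .
    qed
    also have "\<dots> \<le> (1 - a) * ((c + 1) * ?T)"
      using sq a by (intro mult_left_mono) auto
    finally have 1: "D / 2 * mom2 p \<le> (1 - a) * ((c + 1) * ?T)" .
    have "(1 - a) / mom1 p / 6 * mom3 p \<le> (1 - a) / mom1 p / 6 * (c * mom2 p * (1 + mom1 p))"
      using a m c(2) by (intro mult_left_mono) auto
    also have "\<dots> = (1 - a) * (c / 6 * ?T)" by simp
    also have "\<dots> \<le> (1 - a) * ((c + 1) * ?T)"
      using a T c(1) by (intro mult_left_mono mult_right_mono) auto
    finally have 2: "(1 - a) / mom1 p / 6 * mom3 p \<le> (1 - a) * ((c + 1) * ?T)" .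
    have "2 * y * x * T = x * (y * T) + x * (y * T)" for x y T :: real by simp
    from this[of "c + 1" "1 - a" "?T"]
    show "D / 2 * mom2 p + (1 - a) / mom1 p / 6 * mom3 p \<le> 2 * (c + 1) * (1 - a) * ?T"
      using 1 2 by linarith
  qed
  finally show ?thesis .
qed

section \<open>Stein's method for the exponential law\<close>

text \<open>A Lipschitz map sends null sets to null sets, so if \<open>h a < h b\<close>, some level
  y strictly between is missed on the exceptional set. At the last point of \<open>{a..b}\<close>
  where \<open>h\<close> is at most y, it equals y and has negative derivative, although
  \<open>h\<close> exceeds y to the right.\<close>

lemma lipschitz_AE_decreasing:
  fixes h :: "real \<Rightarrow> real"
  assumes L: "L-lipschitz_on UNIV h"
    and ae: "AE x in lborel. h differentiable (at x) \<and> deriv h x < 0"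
    and ab: "a \<le> b"
  shows "h b \<le> h a"
proof (rule ccontr)
  assume "\<not> h b \<le> h a"
  then have lt: "h a < h b" by simp
  have cont: "continuous_on UNIV h" using L by (rule lipschitz_on_continuous_on)
  define S where "S = {x. \<not> (h differentiable (at x) \<and> deriv h x < 0)}"
  have "negligible S"
  proof -
    obtain N where N: "N \<in> null_sets lborel" "S \<subseteq> N"
      using ae by (auto simp: S_def eventually_ae_filter)
    have "N \<in> null_sets lebesgue" using N(1) by (rule null_sets_completionI)
    then show ?thesis using N(2) negligible_iff_null_sets negligible_subset by blast
  qed
  then have "negligible (h ` S)"
  proof (rule negligible_locally_Lipschitz_image[rotated])
    fix x assume "x \<in> S"
    have "norm (h y - h x) \<le> L * norm (y - x)" for y
      using lipschitz_onD[OF L, of y x] by (simp add: dist_norm)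
    then show "\<exists>T B. open T \<and> x \<in> T \<and> (\<forall>y\<in>S \<inter> T. norm (h y - h x) \<le> B * norm (y - x))"
      by (intro exI[of _ UNIV] exI[of _ L]) auto
  qed simp
  moreover have "\<not> negligible {h a<..<h b}"
    using open_not_negligible[of "{h a<..<h b}"] lt by auto
  ultimately obtain y where y: "h a < y" "y < h b" "y \<notin> h ` S"
    using negligible_subset[of "h ` S" "{h a<..<h b}"]
    by (metis greaterThanLessThan_iff subsetI)
  define A where "A = {x \<in> {a..b}. h x \<le> y}"
  have "A = {a..b} \<inter> {x. h x \<le> y}" by (auto simp: A_def)
  moreover have "closed {x. h x \<le> y}" using cont by (intro closed_Collect_le) auto
  ultimately have "compact A" by (simp add: compact_Int_closed)
  moreover have "a \<in> A" using y ab by (simp add: A_def)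
  ultimately obtain x where x: "x \<in> A" "\<And>t. t \<in> A \<Longrightarrow> t \<le> x"
    using compact_attains_sup[of A] by auto
  have xb: "a \<le> x" "x < b" "h x \<le> y" using x(1) y by (auto simp: A_def order.order_iff_strict)
  have above: "y < h t" if "x < t" "t \<le> b" for t
    using x(2)[of t] that xb by (force simp: A_def)
  have "h x = y"
  proof (rule antisym)
    have "\<exists>t\<ge>x. t \<le> b \<and> h t = y"
      using cont xb y by (intro IVT') (auto intro: continuous_on_subset)
    then obtain t where "x \<le> t" "t \<le> b" "h t = y" by auto
    then show "y \<le> h x" using above[of t] by (cases "x = t") auto
  qed (use xb in simp)
  then have "x \<notin> S" using y(3) by auto
  then have "(h has_real_derivative deriv h x) (at x)" "deriv h x < 0"
    by (auto simp: S_def DERIV_deriv_iff_real_differentiable)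
  then obtain d where d: "0 < d" "\<And>e. 0 < e \<Longrightarrow> e < d \<Longrightarrow> h (x + e) < h x"
    using DERIV_neg_dec_right by blast
  define e where "e = min (d / 2) (b - x)"
  have "0 < e" "e < d" "x + e \<le> b" using d(1) xb by (auto simp: e_def)
  then show False using d(2)[of e] above[of "x + e"] \<open>h x = y\<close> by simp
qed

text \<open>Test functions have some Lipschitz constant and an almost everywhere bound on the
  derivative. Tilting \<open>h\<close> and \<open>- h\<close> by a line of slope slightly above 1
  gives decreasing functions, whence the Lipschitz constant can be taken as 1.\<close>

lemma wasserstein_test_contraction:
  assumes "h \<in> wasserstein_test"
  shows "\<bar>h x - h y\<bar> \<le> \<bar>x - y\<bar>"
proof -
  obtain L where L: "L-lipschitz_on UNIV h"
    and ae: "AE x in lborel. h differentiable (at x) \<and> \<bar>deriv h x\<bar> \<le> 1"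
    using assms by (auto simp: wasserstein_test_def)
  have *: "s * (h b - h a) \<le> (1 + e) * (b - a)" if "a \<le> b" "0 < e" "s = 1 \<or> s = -1" for a b e s
  proof -
    \<comment> \<open>The slack \<open>e\<close> makes the derivative strictly negative; it is
      removed in \<open>le\<close>.\<close>
    define g where "g x = s * h x - (1 + e) * x" for x
    have "(\<bar>s\<bar> * L + \<bar>1 + e\<bar> * 1)-lipschitz_on UNIV g"
      unfolding g_def using lipschitz_on_diff[of "\<bar>s\<bar> * L" UNIV "\<lambda>x. s * h x" "\<bar>1 + e\<bar> * 1" "\<lambda>x. (1 + e) * x"]
        lipschitz_on_cmult_real[OF L, of s] lipschitz_on_cmult_real[of 1 UNIV "\<lambda>x. x" "1 + e"]
      by (auto simp: lipschitz_on_def)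
    moreover have "AE x in lborel. g differentiable (at x) \<and> deriv g x < 0"
      using ae
    proof eventually_elim
      case (elim x)
      then have "(h has_real_derivative deriv h x) (at x)"
        by (simp add: DERIV_deriv_iff_real_differentiable)
      then have d: "(g has_real_derivative s * deriv h x - (1 + e)) (at x)"
        unfolding g_def by (auto intro!: derivative_eq_intros)
      have "s * deriv h x - (1 + e) < 0" using elim that by auto
      then show ?case using d by (auto simp: DERIV_imp_deriv real_differentiable_def)
    qed
    ultimately have "g b \<le> g a" using that(1) by (rule lipschitz_AE_decreasing)
    then show ?thesis by (simp add: g_def algebra_simps)
  qed
  have le: "s * (h b - h a) \<le> b - a" if "a \<le> b" "s = 1 \<or> s = -1" for a b s
  proof (rule field_le_epsilon)
    fix e :: real assume "0 < e"
    define d where "d = e / (1 + (b - a))"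
    have d: "0 < d" "d * (b - a) \<le> e"
      using \<open>0 < e\<close> that(1) by (auto simp: d_def field_simps)
    show "s * (h b - h a) \<le> b - a + e"
      using *[OF that(1) d(1) that(2)] d(2) by (simp add: algebra_simps)
  qed
  show ?thesis
  proof (cases "x \<le> y")
    case True
    show ?thesis using le[OF True, of 1] le[OF True, of "-1"] True by auto
  next
    case False
    then have "y \<le> x" by simp
    then show ?thesis using le[of y x 1] le[of y x "-1"] by auto
  qed
qed

section \<open>The exponential law and its Stein equation\<close>

abbreviation std_exponential :: "real measure" where
  "std_exponential \<equiv> density lborel (\<lambda>x. ennreal (exponential_density 1 x))"

text \<open>H(x) = E h(x + T) with T standard exponential. On the nonnegative reals H' = H - h, and
  H(0) = E h(T), so H yields the solution of the Stein equation.\<close>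

definition exp_shift :: "(real \<Rightarrow> real) \<Rightarrow> real \<Rightarrow> real" where
  "exp_shift h x = (\<integral>t. h (x + t) \<partial>std_exponential)"

lemma prob_space_std_exponential: "prob_space std_exponential"
  by (rule prob_space_exponential_density) simp

lemma integrable_std_exponential_id: "integrable std_exponential (\<lambda>t. t)"
  and integral_std_exponential_id: "(\<integral>t. t \<partial>std_exponential) = 1"
proof -
  have nn: "AE x in lborel. 0 \<le> exponential_density 1 x" by (simp add: exponential_density_nonneg)
  have "has_bochner_integral lborel (\<lambda>x. exponential_density 1 x * x ^ 1) 1"
    using nn_integral_erlang_ith_moment[of 1 0 1] nn
    by (intro has_bochner_integral_nn_integral) (auto simp: exponential_density_def)
  then show "integrable std_exponential (\<lambda>t. t)" "(\<integral>t. t \<partial>std_exponential) = 1"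
    using nn by (auto simp: integrable_density integral_density has_bochner_integral_iff)
qed

lemma AE_std_exponential: "AE t in std_exponential. 0 \<le> t"
  by (subst AE_density) (auto simp: exponential_density_def)

context
  fixes h :: "real \<Rightarrow> real"
  assumes contr: "\<And>x y. \<bar>h x - h y\<bar> \<le> \<bar>x - y\<bar>"
begin

interpretation E: prob_space std_exponential by (rule prob_space_std_exponential)

lemma contraction_continuous: "continuous_on A h"
proof -
  have "1-lipschitz_on A h" using contr by (intro lipschitz_onI) (auto simp: dist_real_def)
  then show ?thesis by (rule lipschitz_on_continuous_on)
qed

lemma contraction_measurable: "h \<in> borel_measurable borel"
  by (intro borel_measurable_continuous_onI contraction_continuous)

lemma exp_shift_integrable: "integrable std_exponential (\<lambda>t. h (x + t))"
proof (rule Bochner_Integration.integrable_bound)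
  note [measurable] = contraction_measurable
  show "(\<lambda>t. h (x + t)) \<in> borel_measurable std_exponential" by simp
  show "integrable std_exponential (\<lambda>t. \<bar>h x\<bar> + \<bar>t\<bar>)"
    using integrable_std_exponential_id by simp
  show "AE t in std_exponential. norm (h (x + t)) \<le> norm (\<bar>h x\<bar> + \<bar>t\<bar>)"
  proof (rule AE_I2)
    fix t show "norm (h (x + t)) \<le> norm (\<bar>h x\<bar> + \<bar>t\<bar>)" using contr[of "x + t" x] by simp
  qed
qed

lemma exp_shift_contraction: "\<bar>exp_shift h x - exp_shift h y\<bar> \<le> \<bar>x - y\<bar>"
proof -
  have "\<bar>exp_shift h x - exp_shift h y\<bar> = \<bar>(\<integral>t. h (x + t) - h (y + t) \<partial>std_exponential)\<bar>"
    using exp_shift_integrable by (simp add: exp_shift_def)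
  also have "\<dots> \<le> (\<integral>t. \<bar>h (x + t) - h (y + t)\<bar> \<partial>std_exponential)"
    by (rule integral_abs_bound)
  also have "\<dots> \<le> (\<integral>t. \<bar>x - y\<bar> \<partial>std_exponential)"
    using contr[of "x + t" "y + t" for t] exp_shift_integrable
    by (intro integral_mono) auto
  finally show ?thesis using E.prob_space by simp
qed

text \<open>The exponential variable is nonnegative with mean 1, and \<open>h\<close> moves by at
  most its value.\<close>

lemma exp_shift_near: "\<bar>h x - exp_shift h x\<bar> \<le> 1"
proof -
  have "\<bar>h x - exp_shift h x\<bar> = \<bar>(\<integral>t. h x - h (x + t) \<partial>std_exponential)\<bar>"
    using exp_shift_integrable[of x] E.prob_space by (simp add: exp_shift_def)
  also have "\<dots> \<le> (\<integral>t. \<bar>h x - h (x + t)\<bar> \<partial>std_exponential)"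
    by (rule integral_abs_bound)
  also have "\<dots> \<le> (\<integral>t. t \<partial>std_exponential)"
  proof (rule integral_mono_AE)
    show "AE t in std_exponential. \<bar>h x - h (x + t)\<bar> \<le> t"
      using AE_std_exponential
    proof eventually_elim
      case (elim t) then show ?case using contr[of x "x + t"] by simp
    qed
  qed (use exp_shift_integrable[of x] integrable_std_exponential_id in auto)
  finally show ?thesis by (simp add: integral_std_exponential_id)
qed

text \<open>Substitution turns H(x) into exp x times the integral of exp(-t) h(t) over t >= x;
  splitting off \<open>{0..x}\<close> leaves a form to which the fundamental theorem of calculus
  applies.\<close>

lemma exp_shift_eq:
  assumes "0 \<le> x"
  shows "exp_shift h x = exp x * (exp_shift h 0 - integral {0..x} (\<lambda>t. exp (- t) * h t))"
proof -
  note [measurable] = contraction_measurable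
  let ?g = "\<lambda>t. indicator {0..} t * (exp (- t) * h t) :: real"
  have nn: "AE x in lborel. 0 \<le> exponential_density 1 x" by (simp add: exponential_density_nonneg)
  have ed: "exponential_density 1 t = indicator {0..} t * exp (- t)" for t :: real
    by (auto simp: exponential_density_def indicator_def)
  have int: "integrable lborel (\<lambda>t. indicator {0..} t * (exp (- t) * h (y + t)))"
    and eq: "exp_shift h y = (\<integral>t. indicator {0..} t * (exp (- t) * h (y + t)) \<partial>lborel)" for y
    using exp_shift_integrable[of y] nn
    by (auto simp: exp_shift_def integrable_density integral_density ed mult.assoc)
  have "continuous_on {0..x} (\<lambda>t. exp (- t) * h t)"
    by (intro continuous_intros contraction_continuous)
  then have ix: "integrable lborel (\<lambda>t. indicator {0..x} t * (exp (- t) * h t))"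
    using borel_integrable_compact[of "{0..x}" "\<lambda>t. exp (- t) * h t"] by simp
  have "exp_shift h x = (\<integral>t. indicator {0..} t * (exp (- t) * h (x + t)) \<partial>lborel)" by (rule eq)
  also have "\<dots> = (\<integral>t. indicator {x..} (x + 1 * t) * (exp (x - (x + 1 * t)) * h (x + 1 * t)) \<partial>lborel)"
    by (intro Bochner_Integration.integral_cong) (auto simp: indicator_def)
  also have "\<dots> = (\<integral>t. indicator {x..} t * (exp (x - t) * h t) \<partial>lborel)"
    using lborel_integral_real_affine[of 1 "\<lambda>t. indicator {x..} t * (exp (x - t) * h t)" x] by simp
  also have "\<dots> = (\<integral>t. exp x * (?g t - indicator {0..x} t * (exp (- t) * h t)) \<partial>lborel)"
  proof (rule integral_cong_AE)
    \<comment> \<open>Both \<open>{x..}\<close> and \<open>{0..x}\<close> contain \<open>x\<close>,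
      so the pointwise identity can fail at this single point.\<close>
    have "AE t in lborel. t \<noteq> x" by (rule AE_lborel_singleton)
    then show "AE t in lborel. indicator {x..} t * (exp (x - t) * h t)
        = exp x * (?g t - indicator {0..x} t * (exp (- t) * h t))"
      by eventually_elim (use assms in \<open>auto simp: indicator_def exp_diff exp_minus field_simps\<close>)
  qed auto
  also have "\<dots> = exp x * ((\<integral>t. ?g t \<partial>lborel) - (\<integral>t. indicator {0..x} t * (exp (- t) * h t) \<partial>lborel))"
    using int[of 0] ix by simp
  also have "(\<integral>t. indicator {0..x} t * (exp (- t) * h t) \<partial>lborel) = integral {0..x} (\<lambda>t. exp (- t) * h t)"
    using set_borel_integral_eq_integral(2)[of "{0..x}" "\<lambda>t. exp (- t) * h t"] ix
    by (simp add: set_integrable_def set_lebesgue_integral_def)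
  finally show ?thesis using eq[of 0] by simp
qed

text \<open>The mean value theorem for H' = H - h. The closed form of H holds on the nonnegative
  reals, so derivatives are taken within \<open>{0..y}\<close>.\<close>

lemma exp_shift_mvt:
  assumes "0 \<le> x" "x < y"
  shows "\<exists>z. x < z \<and> z < y \<and> exp_shift h y - exp_shift h x = (y - x) * (exp_shift h z - h z)"
proof -
  define G where "G x = exp x * (exp_shift h 0 - integral {0..x} (\<lambda>t. exp (- t) * h t))" for x
  have G: "exp_shift h z = G z" if "0 \<le> z" for z using exp_shift_eq[OF that] by (simp add: G_def)
  have cont: "continuous_on {0..y} (\<lambda>t. exp (- t) * h t)"
    by (intro continuous_intros contraction_continuous)
  have deriv: "(G has_real_derivative G z - h z) (at z within {0..y})" if "z \<in> {0..y}" for z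
  proof -
    have "((\<lambda>x. integral {0..x} (\<lambda>t. exp (- t) * h t)) has_real_derivative exp (- z) * h z) (at z within {0..y})"
      using integral_has_real_derivative[OF cont that] .
    then have "(G has_real_derivative exp z * (exp_shift h 0 - integral {0..z} (\<lambda>t. exp (- t) * h t))
        - exp z * (exp (- z) * h z)) (at z within {0..y})"
      unfolding G_def by (auto intro!: derivative_eq_intros)
    moreover have "exp z * (exp (- z) * h z) = h z"
      by (simp add: mult.assoc[symmetric] exp_minus_inverse)
    ultimately show ?thesis by (simp add: G_def)
  qed
  have "\<exists>z\<in>{x<..<y}. G y - G x = (G z - h z) * (y - x)"
  proof (rule mvt_simple)
    fix z assume "x \<le> z" "z \<le> y"
    then have "(G has_real_derivative G z - h z) (at z within {x..y})"
      using assms by (intro DERIV_subset[OF deriv]) auto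
    then show "(G has_derivative (*) (G z - h z)) (at z within {x..y})"
      by (simp add: has_field_derivative_def)
  qed fact
  then show ?thesis using G assms by (auto simp: mult.commute)
qed
end

section \<open>The distance of V_0 and V_1 under compounding\<close>

lemma expectation_bind_pmf:
  fixes h :: "'b \<Rightarrow> real"
  assumes "\<And>y. \<bar>h y\<bar> \<le> B"
  shows "(\<integral>y. h y \<partial>measure_pmf (bind_pmf p f)) =
    (\<integral>x. (\<integral>y. h y \<partial>measure_pmf (f x)) \<partial>measure_pmf p)"
  unfolding measure_pmf_bind
  by (rule integral_bind[where K = "count_space UNIV" and B = B and B' = 1])
     (use assms measurable_measure_pmf[of f] in \<open>auto simp: measure_pmf.emeasure_space_1\<close>)

lemma expectation_bounded:
  fixes h :: "'b \<Rightarrow> real"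
  assumes "\<And>y. \<bar>h y\<bar> \<le> B"
  shows "\<bar>\<integral>y. h y \<partial>measure_pmf p\<bar> \<le> B"
proof -
  have "\<bar>\<integral>y. h y \<partial>measure_pmf p\<bar> \<le> (\<integral>y. \<bar>h y\<bar> \<partial>measure_pmf p)" by (rule integral_abs_bound)
  also have "\<dots> \<le> B"
    using assms integrable_bounded_pmf[of h B p] by (intro measure_pmf.integral_le_const) auto
  finally show ?thesis .
qed

lemma expectation_diff_bounded:
  fixes h g :: "'b \<Rightarrow> real"
  assumes "\<And>y. \<bar>h y\<bar> \<le> B" "\<And>y. \<bar>g y\<bar> \<le> C" "\<And>y. \<bar>h y - g y\<bar> \<le> D"
  shows "\<bar>(\<integral>y. h y \<partial>measure_pmf p) - (\<integral>y. g y \<partial>measure_pmf p)\<bar> \<le> D"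
  using expectation_bounded[of "\<lambda>y. h y - g y" D p] assms
    integrable_bounded_pmf[of h B p] integrable_bounded_pmf[of g C p] by simp

text \<open>Means of compound laws are computed in the extended reals; this converts a finite
  positive one into the hypotheses of the real-valued estimates.\<close>

lemma nn_mean_facts:
  assumes "(\<integral>\<^sup>+ j. of_nat j \<partial>measure_pmf p) = ennreal m" "0 < m"
  shows "integrable (measure_pmf p) real" "mom1 p = m" "\<exists>j\<in>set_pmf p. j \<noteq> 0"
proof -
  have eq: "(\<integral>\<^sup>+ j. ennreal (real j) \<partial>measure_pmf p) = ennreal m"
    using assms(1) by (simp add: ennreal_of_nat_eq_real_of_nat)
  show int: "integrable (measure_pmf p) real"
    by (rule integrableI_nn_integral_finite[OF _ _ eq]) auto
  show "mom1 p = m" unfolding mom1_def using assms(2) eq by (subst integral_eq_nn_integral) auto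
  show "\<exists>j\<in>set_pmf p. j \<noteq> 0"
  proof (rule ccontr)
    assume "\<not> ?thesis"
    then have "(\<integral>\<^sup>+ j. ennreal (real j) \<partial>measure_pmf p) = (\<integral>\<^sup>+ j. 0 \<partial>measure_pmf p)"
      by (intro nn_integral_cong_AE) (auto simp: AE_measure_pmf_iff)
    then show False using eq assms(2) by simp
  qed
qed

lemma nn_mean_compound:
  "(\<integral>\<^sup>+ j. of_nat j \<partial>measure_pmf (compound p q)) =
    (\<integral>\<^sup>+ j. of_nat j \<partial>measure_pmf p) * (\<integral>\<^sup>+ j. of_nat j \<partial>measure_pmf q)"
  by (simp add: nn_integral_compound nn_integral_iid_sum nn_integral_multc)

text \<open>\<open>secant_gap p e\<close> bounds the Wasserstein distance between the laws \<open>secant_pmf 0 p\<close> and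
  \<open>secant_pmf 1 p\<close> by \<open>e\<close>. Bounded test functions suffice for Stein's method and make every
  expectation exist.\<close>

definition secant_gap :: "nat pmf \<Rightarrow> real \<Rightarrow> bool" where
  "secant_gap p e \<longleftrightarrow> (\<forall>(h :: nat \<Rightarrow> real) B L. (\<forall>m. \<bar>h m\<bar> \<le> B) \<longrightarrow>
     (\<forall>m n. \<bar>h m - h n\<bar> \<le> L * \<bar>real m - real n\<bar>) \<longrightarrow>
     \<bar>(\<integral>m. h m \<partial>measure_pmf (secant_pmf 0 p)) - (\<integral>m. h m \<partial>measure_pmf (secant_pmf 1 p))\<bar> \<le> L * e)"

lemma secant_gapD:
  fixes h :: "nat \<Rightarrow> real"
  assumes "secant_gap p e" "\<And>m. \<bar>h m\<bar> \<le> B" "\<And>m n. \<bar>h m - h n\<bar> \<le> L * \<bar>real m - real n\<bar>"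
  shows "\<bar>(\<integral>m. h m \<partial>measure_pmf (secant_pmf 0 p)) - (\<integral>m. h m \<partial>measure_pmf (secant_pmf 1 p))\<bar> \<le> L * e"
  using assms unfolding secant_gap_def by blast

text \<open>The generating function t has constant divided difference 1, so every V_a is the unit
  mass at 0.\<close>

lemma secant_gap_return_1: "secant_gap (return_pmf 1) 0"
  unfolding secant_gap_def
proof (intro allI impI)
  fix h :: "nat \<Rightarrow> real" and B L :: real
  assume h: "\<forall>m. \<bar>h m\<bar> \<le> B"
  have "(\<integral>m. h m \<partial>measure_pmf (secant_pmf (ennreal a) (return_pmf 1))) = h 0" if "0 \<le> a" "a \<le> 1" for a
    using that h by (subst expectation_secant_pmf[where B = B])
      (auto simp: secant_def intro!: integrable_measure_pmf_finite)
  from this[of 0] this[of 1]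
  show "\<bar>(\<integral>m. h m \<partial>measure_pmf (secant_pmf 0 (return_pmf 1)))
      - (\<integral>m. h m \<partial>measure_pmf (secant_pmf 1 (return_pmf 1)))\<bar> \<le> L * 0" by simp
qed

text \<open>By the chain rule, V_0 and V_1 of the compound are a sum of m copies of \<open>q\<close>
  plus one variable from V_0(\<open>q\<close>) or V_1(\<open>q\<close>), with m drawn from
  V_a(\<open>p\<close>) for \<open>a = pmf q 0\<close> or from V_1(\<open>p\<close>). Replacing the
  last summand costs \<open>e\<close>; replacing the law of m is covered by
  \<open>secant_pmf_close\<close>, each unit of m being worth \<open>mom1 q\<close> on
  average.\<close>

lemma secant_gap_compound:
  assumes gap: "secant_gap q e"
    and q: "integrable (measure_pmf q) real" "\<exists>j\<in>set_pmf q. j \<noteq> 0"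
    and p: "integrable (measure_pmf p) (\<lambda>j. real j ^ 3)" "\<exists>j\<in>set_pmf p. j \<noteq> 0"
    and c: "0 \<le> c" "mom3 p \<le> c * mom2 p * (1 + mom1 p)"
  shows "secant_gap (compound p q)
    (e + mom1 q * (2 * (c + 1) * (1 - pmf q 0) * (mom2 p / mom1 p * (1 + mom1 p))))"
    (is "secant_gap _ (e + mom1 q * ?d)")
  unfolding secant_gap_def
proof (intro allI impI)
  fix h :: "nat \<Rightarrow> real" and B L :: real
  assume "\<forall>m. \<bar>h m\<bar> \<le> B" and "\<forall>m n. \<bar>h m - h n\<bar> \<le> L * \<bar>real m - real n\<bar>"
  then have B: "\<bar>h m\<bar> \<le> B" and L: "\<bar>h m - h n\<bar> \<le> L * \<bar>real m - real n\<bar>" for m n by auto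
  have L0: "0 \<le> L" using order_trans[OF abs_ge_zero L[of 0 1]] by simp
  note pint = integrable_falling(1)[OF p(1)]
  define a where "a = pmf q 0"
  have a: "0 \<le> a" "a \<le> 1" by (auto simp: a_def pmf_le_1)
  \<comment> \<open>\<open>\<psi>\<close> averages over the summand from the secant law of
    \<open>q\<close>, \<open>\<phi>\<close> also over the m copies of \<open>q\<close>.\<close>
  define \<psi> where "\<psi> \<alpha> s = (\<integral>i. h (s + i) \<partial>measure_pmf (secant_pmf \<alpha> q))" for \<alpha> s
  define \<phi> where "\<phi> \<alpha> m = (\<integral>s. \<psi> \<alpha> s \<partial>measure_pmf (iid_sum q m))" for \<alpha> m
  have \<psi>B: "\<bar>\<psi> \<alpha> s\<bar> \<le> B" for \<alpha> s unfolding \<psi>_def by (intro expectation_bounded B)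
  have \<phi>B: "\<bar>\<phi> \<alpha> s\<bar> \<le> B" for \<alpha> s unfolding \<phi>_def by (intro expectation_bounded \<psi>B)
  have chain: "(\<integral>m. h m \<partial>measure_pmf (secant_pmf (ennreal \<alpha>) (compound p q)))
     = (\<integral>m. \<phi> (ennreal \<alpha>) m \<partial>measure_pmf (secant_pmf (ennreal \<beta>) p))"
    if "0 \<le> \<alpha>" "\<alpha> \<le> 1" "\<beta> = gf q \<alpha>" for \<alpha> \<beta>
  proof -
    have \<beta>: "0 \<le> \<beta>" "\<beta> \<le> 1" "egf q (ennreal \<alpha>) = ennreal \<beta>"
      using that gf_bounds egf_eq_gf by auto
    have "secant_pmf (ennreal \<alpha>) (compound p q) =
      bind_pmf (secant_pmf (ennreal \<beta>) p) (\<lambda>m. bind_pmf (iid_sum q m)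
        (\<lambda>s. map_pmf (\<lambda>i. s + i) (secant_pmf (ennreal \<alpha>) q)))"
      using secant_pmf_compound[of q "ennreal \<alpha>" p]
        secant_mass_finite_pos[OF pint p(2) \<beta>(1,2)] secant_mass_finite_pos[OF q that(1,2)]
      unfolding \<beta>(3) by blast
    then show ?thesis
      by (simp add: expectation_bind_pmf[where h = h, OF B] \<phi>_def \<psi>_def)
  qed
  have e: "\<bar>\<phi> 0 m - \<phi> 1 m\<bar> \<le> L * e" for m
    unfolding \<phi>_def
  proof (rule expectation_diff_bounded[OF \<psi>B \<psi>B])
    fix s
    have "\<bar>h (s + i) - h (s + j)\<bar> \<le> L * \<bar>real i - real j\<bar>" for i j
      using L[of "s + i" "s + j"] by simp
    then show "\<bar>\<psi> 0 s - \<psi> 1 s\<bar> \<le> L * e"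
      unfolding \<psi>_def by (intro secant_gapD[OF gap, of _ B]) (auto intro: B)
  qed
  have mean: "(\<integral>\<^sup>+ s. of_nat s \<partial>measure_pmf (iid_sum q m)) = ennreal (real m * mom1 q)" for m
  proof -
    have qm: "(\<integral>\<^sup>+ s. of_nat s \<partial>measure_pmf q) = ennreal (mom1 q)"
      using q(1) unfolding mom1_def by (simp add: ennreal_of_nat_eq_real_of_nat nn_integral_eq_integral)
    show ?thesis
      using mom1_pos[OF q] unfolding nn_integral_iid_sum qm
      by (simp add: ennreal_mult ennreal_of_nat_eq_real_of_nat)
  qed
  \<comment> \<open>The sum of m copies has mean \<open>real m * mom1 q\<close>;
    \<open>m = 0\<close> is separate because \<open>nn_mean_facts\<close> asks for a positive
    mean.\<close>
  have \<phi>L: "\<bar>\<phi> 1 m - \<phi> 1 0\<bar> \<le> L * mom1 q * real m" for m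
  proof (cases "m = 0")
    case False
    then have "0 < real m * mom1 q" using mom1_pos[OF q] by simp
    note mm = nn_mean_facts[OF mean this]
    have \<psi>L: "\<bar>\<psi> 1 s - \<psi> 1 0\<bar> \<le> L * real s" for s
      unfolding \<psi>_def
    proof (rule expectation_diff_bounded[of _ B _ B])
      fix i show "\<bar>h (s + i) - h (0 + i)\<bar> \<le> L * real s" using L[of "s + i" i] by simp
    qed (auto intro: B)
    have "\<bar>\<phi> 1 m - \<phi> 1 0\<bar> = \<bar>\<integral>s. \<psi> 1 s - \<psi> 1 0 \<partial>measure_pmf (iid_sum q m)\<bar>"
      using integrable_bounded_pmf[of "\<psi> 1" B] \<psi>B by (simp add: \<phi>_def)
    also have "\<dots> \<le> (\<integral>s. \<bar>\<psi> 1 s - \<psi> 1 0\<bar> \<partial>measure_pmf (iid_sum q m))"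
      by (rule integral_abs_bound)
    also have "\<dots> \<le> (\<integral>s. L * real s \<partial>measure_pmf (iid_sum q m))"
      using integrable_bounded_pmf[of "\<psi> 1" B] \<psi>B mm(1) \<psi>L by (intro integral_mono) auto
    also have "\<dots> = L * (real m * mom1 q)" using mm(2) by (simp add: mom1_def)
    finally show ?thesis by (simp add: mult.commute mult.left_commute)
  qed simp
  have "(\<integral>m. h m \<partial>measure_pmf (secant_pmf 0 (compound p q)))
      = (\<integral>m. \<phi> 0 m \<partial>measure_pmf (secant_pmf (ennreal a) p))"
    using chain[of 0 a] by (simp add: gf_0 a_def)
  moreover have "(\<integral>m. h m \<partial>measure_pmf (secant_pmf 1 (compound p q)))
      = (\<integral>m. \<phi> 1 m \<partial>measure_pmf (secant_pmf 1 p))"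
    using chain[of 1 1] by (simp add: gf_def)
  moreover have "\<bar>(\<integral>m. \<phi> 0 m \<partial>measure_pmf (secant_pmf (ennreal a) p))
      - (\<integral>m. \<phi> 1 m \<partial>measure_pmf (secant_pmf (ennreal a) p))\<bar> \<le> L * e"
    by (rule expectation_diff_bounded[OF \<phi>B \<phi>B e])
  moreover have "\<bar>(\<integral>m. \<phi> 1 m \<partial>measure_pmf (secant_pmf (ennreal a) p))
      - (\<integral>m. \<phi> 1 m \<partial>measure_pmf (secant_pmf 1 p))\<bar> \<le> L * mom1 q * ?d"
    using secant_pmf_close[OF p a c \<phi>B \<phi>L] by (simp add: a_def)
  ultimately show "\<bar>(\<integral>m. h m \<partial>measure_pmf (secant_pmf 0 (compound p q)))
      - (\<integral>m. h m \<partial>measure_pmf (secant_pmf 1 (compound p q)))\<bar> \<le> L * (e + mom1 q * ?d)"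
    by (simp add: distrib_left mult.assoc)
qed

text \<open>At \<open>a = 0\<close> the power \<open>0 ^ (j - 1 - m)\<close> leaves only
  \<open>m = j - 1\<close>, so V_0 is the law of Z - 1 given Z > 0.\<close>

lemma expectation_secant_pmf_0:
  fixes k :: "nat \<Rightarrow> real"
  assumes int: "integrable (measure_pmf p) real" and nz: "\<exists>j\<in>set_pmf p. j \<noteq> 0"
    and k: "\<And>m. \<bar>k m\<bar> \<le> B"
  shows "(\<integral>m. k m \<partial>measure_pmf (secant_pmf 0 p)) =
    (\<integral>j. (if j = 0 then 0 else k (j - 1)) \<partial>measure_pmf p) / (1 - pmf p 0)"
proof -
  have "(\<Sum>m<j. 0 ^ (j - 1 - m) * k m) = (if j = 0 then 0 else k (j - 1))" for j
  proof (cases j)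
    case (Suc i)
    have "(\<Sum>m<Suc i. 0 ^ (i - m) * k m) = (\<Sum>m<i. 0) + k i"
      unfolding sum.lessThan_Suc by (intro arg_cong2[of _ _ _ _ "(+)"] sum.cong) auto
    then show ?thesis by (simp add: Suc)
  qed simp
  moreover have "secant p 0 = 1 - pmf p 0" using secant_eq[OF int, of 0] by (simp add: gf_0)
  ultimately show ?thesis using expectation_secant_pmf[OF int nz _ _ k, of 0] by simp
qed

text \<open>Stein's method: \<open>f = exp_shift h 0 - exp_shift h\<close> solves \<open>f' - f = h - exp_shift h 0\<close>, and the
  expectation of \<open>f\<close> is turned into one of \<open>f'\<close> under the equilibrium law \<open>secant_pmf 1 p\<close>.\<close>

lemma conditional_exponential_bound:
  fixes h :: "real \<Rightarrow> real"
  assumes contr: "\<And>x y. \<bar>h x - h y\<bar> \<le> \<bar>x - y\<bar>"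
    and int: "integrable (measure_pmf p) real" and nz: "\<exists>j\<in>set_pmf p. j \<noteq> 0"
    and gap: "secant_gap p e" and b: "b = mom1 p / (1 - pmf p 0)"
  shows "\<bar>(\<integral>j. (if j = 0 then 0 else h (real j / b)) \<partial>measure_pmf p) / (1 - pmf p 0)
      - (\<integral>t. h t \<partial>std_exponential)\<bar> \<le> 2 / b * (1 + e)"
proof -
  define u where "u = 1 - pmf p 0"
  have u: "0 < u" using secant_pos[OF int, of 0] nz secant_eq[OF int, of 0] by (simp add: gf_0 u_def)
  have m: "0 < mom1 p" using int nz by (rule mom1_pos)
  have b0: "0 < b" using m u by (simp add: b u_def)
  let ?H = "exp_shift h"
  \<comment> \<open>\<open>k\<close> is -H', and \<open>b * \<Delta> j\<close> is the difference
    quotient of H over a step \<open>1 / b\<close>; the two nearly cancel.\<close>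
  define k where "k x = h x - ?H x" for x
  define g where "g j = ?H (real j / b) - ?H 0" for j
  define \<Delta> where "\<Delta> j = g (Suc j) - g j" for j
  have k1: "\<bar>k x\<bar> \<le> 1" for x using exp_shift_near[of h x] contr by (simp add: k_def)
  have k2: "\<bar>k x - k y\<bar> \<le> 2 * \<bar>x - y\<bar>" for x y
    unfolding k_def using exp_shift_contraction[of h x y, OF contr] contr[of x y] by (smt (verit))
  have gb: "\<bar>g j\<bar> \<le> real j / b" for j
    using exp_shift_contraction[of h "real j / b" 0] contr b0 by (simp add: g_def)
  have \<Delta>b: "\<bar>b * \<Delta> j\<bar> \<le> 1" for j
  proof -
    have "\<bar>\<Delta> j\<bar> \<le> \<bar>real (Suc j) / b - real j / b\<bar>"
      using exp_shift_contraction[of h "real (Suc j) / b" "real j / b"] contr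
      by (simp add: g_def \<Delta>_def)
    also have "\<dots> = 1 / b" using b0 by (simp add: diff_divide_distrib[symmetric])
    finally show ?thesis using b0 by (simp add: abs_mult field_simps)
  qed
  \<comment> \<open>The difference quotient is -k at an intermediate point, which is within
    \<open>1 / b\<close> of the right end; \<open>k\<close> has Lipschitz constant 2.\<close>
  have \<Delta>k: "\<bar>k (real (Suc j) / b) - (- (b * \<Delta> j))\<bar> \<le> 2 / b" for j
  proof -
    obtain z where z: "real j / b < z" "z < real (Suc j) / b"
      "?H (real (Suc j) / b) - ?H (real j / b) = (real (Suc j) / b - real j / b) * (?H z - h z)"
      using exp_shift_mvt[of h "real j / b" "real (Suc j) / b"] contr b0
      by (auto simp: divide_strict_right_mono)
    have step: "real (Suc j) / b - real j / b = 1 / b" by (simp add: diff_divide_distrib[symmetric])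
    have "- (b * \<Delta> j) = k z" using z(3) b0 unfolding step by (simp add: \<Delta>_def g_def k_def)
    moreover have "\<bar>k (real (Suc j) / b) - k z\<bar> \<le> 2 * (1 / b)"
      using k2[of "real (Suc j) / b" z] z(1,2) step by (smt (verit))
    ultimately show ?thesis by simp
  qed
  \<comment> \<open>The defining property of the equilibrium law: since \<open>g 0 = 0\<close>, the
    increments \<open>\<Delta> i\<close> over \<open>i < j\<close> sum to \<open>g j\<close>. The
    choice of \<open>b\<close> makes the normalising constants agree.\<close>
  have mean_g: "(\<integral>j. g j \<partial>measure_pmf p) / u = (\<integral>j. b * \<Delta> j \<partial>measure_pmf (secant_pmf 1 p))"
  proof -
    have "(\<Sum>i<j. b * \<Delta> i) = b * g j" for j
      by (simp add: sum_distrib_left[symmetric] \<Delta>_def sum_lessThan_telescope) (simp add: g_def)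
    then have "(\<integral>j. b * \<Delta> j \<partial>measure_pmf (secant_pmf 1 p)) = (\<integral>j. b * g j \<partial>measure_pmf p) / mom1 p"
      using expectation_secant_pmf[OF int nz _ _ \<Delta>b, of 1] by (simp add: secant_1)
    then show ?thesis using m by (auto simp: b u_def)
  qed
  have int_g: "integrable (measure_pmf p) g"
    using int b0 gb by (intro Bochner_Integration.integrable_bound[of _ "\<lambda>j. real j / b" g]) auto
  have int_k: "integrable (measure_pmf p) (\<lambda>j. if j = 0 then 0 else k (real j / b))"
    using k1 by (intro integrable_bounded_pmf[of _ 1]) auto
  have int_i: "integrable (measure_pmf p) (\<lambda>j. if j = 0 then 0 else ?H 0)"
    by (intro integrable_bounded_pmf[of _ "\<bar>?H 0\<bar>"]) auto
  have "(\<integral>j. (if j = 0 then 0 else ?H 0) \<partial>measure_pmf p)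
      = (\<integral>j. ?H 0 - ?H 0 * indicator {0} j \<partial>measure_pmf p)"
    by (intro Bochner_Integration.integral_cong) auto
  also have "\<dots> = ?H 0 * u"
    using integrable_bounded_pmf[of "indicator {0}" 1 p]
    by (subst Bochner_Integration.integral_diff) (auto simp: u_def pmf.rep_eq algebra_simps)
  finally have i: "(\<integral>j. (if j = 0 then 0 else ?H 0) \<partial>measure_pmf p) = ?H 0 * u" .
  \<comment> \<open>For \<open>j > 0\<close> this is h = k + (H - H(0)) + H(0); as
    \<open>g 0 = 0\<close>, the middle term can be integrated without the restriction to
    \<open>j > 0\<close>.\<close>
  have "(\<integral>j. (if j = 0 then 0 else h (real j / b)) \<partial>measure_pmf p)
     = (\<integral>j. (if j = 0 then 0 else k (real j / b)) + g j + (if j = 0 then 0 else ?H 0) \<partial>measure_pmf p)"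
    by (intro Bochner_Integration.integral_cong) (auto simp: k_def g_def)
  also have "\<dots> = (\<integral>j. (if j = 0 then 0 else k (real j / b)) \<partial>measure_pmf p)
     + (\<integral>j. g j \<partial>measure_pmf p) + ?H 0 * u"
    using int_g int_k int_i i by simp
  finally have "(\<integral>j. (if j = 0 then 0 else h (real j / b)) \<partial>measure_pmf p) / u
     = (\<integral>j. (if j = 0 then 0 else k (real j / b)) \<partial>measure_pmf p) / u
     + (\<integral>j. g j \<partial>measure_pmf p) / u + ?H 0"
    using u by (simp add: add_divide_distrib)
  moreover have "(\<integral>j. (if j = 0 then 0 else k (real j / b)) \<partial>measure_pmf p) / u
      = (\<integral>m. k (real (Suc m) / b) \<partial>measure_pmf (secant_pmf 0 p))"
  proof -
    have "(if j = 0 then 0 else k (real j / b)) = (if j = 0 then 0 else k (real (Suc (j - 1)) / b))"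
      for j by simp
    then show ?thesis
      using expectation_secant_pmf_0[OF int nz, of "\<lambda>m. k (real (Suc m) / b)" 1] k1
      by (simp only: u_def)
  qed
  moreover have "(\<integral>j. b * \<Delta> j \<partial>measure_pmf (secant_pmf 1 p))
      = - (\<integral>j. - (b * \<Delta> j) \<partial>measure_pmf (secant_pmf 1 p))" by simp
  moreover have "\<bar>(\<integral>m. k (real (Suc m) / b) \<partial>measure_pmf (secant_pmf 1 p))
      - (\<integral>j. - (b * \<Delta> j) \<partial>measure_pmf (secant_pmf 1 p))\<bar> \<le> 2 / b"
    using k1 \<Delta>b by (intro expectation_diff_bounded[where B = 1 and C = 1, OF _ _ \<Delta>k]) auto
  \<comment> \<open>The argument is \<open>Suc m\<close> because V_0 is the conditional law of Z -
    1. As a function of m it has Lipschitz constant \<open>2 / b\<close>.\<close>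
  moreover have "\<bar>(\<integral>m. k (real (Suc m) / b) \<partial>measure_pmf (secant_pmf 0 p))
      - (\<integral>m. k (real (Suc m) / b) \<partial>measure_pmf (secant_pmf 1 p))\<bar> \<le> 2 / b * e"
  proof (rule secant_gapD[OF gap])
    fix m n
    have "\<bar>real (Suc m) / b - real (Suc n) / b\<bar> = \<bar>real m - real n\<bar> / b"
      using b0 by (simp add: diff_divide_distrib[symmetric])
    then show "\<bar>k (real (Suc m) / b) - k (real (Suc n) / b)\<bar> \<le> 2 / b * \<bar>real m - real n\<bar>"
      using k2[of "real (Suc m) / b" "real (Suc n) / b"] by simp
  qed (rule k1)
  moreover have "?H 0 = (\<integral>t. h t \<partial>std_exponential)" by (simp add: exp_shift_def)
  moreover have "2 / b * (1 + e) = 2 / b + 2 / b * e" by (simp add: distrib_left)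
  ultimately show ?thesis using mean_g unfolding u_def[symmetric] by linarith
qed

section \<open>The law of the process\<close>

text \<open>The offspring after \<open>d\<close> further generations of one individual of generation
  \<open>k\<close>. Peeling off the first generation suits backward induction on \<open>k\<close>;
  the process itself grows at the other end, which \<open>descendants_Suc_right\<close>
  provides.\<close>

primrec descendants :: "(nat \<Rightarrow> nat pmf) \<Rightarrow> nat \<Rightarrow> nat \<Rightarrow> nat pmf" where
  "descendants q k 0 = return_pmf 1"
| "descendants q k (Suc d) = compound (q (Suc k)) (descendants q (Suc k) d)"

lemma descendants_Suc_right:
  "descendants q k (Suc d) = compound (descendants q k d) (q (Suc (k + d)))"
proof (induction d arbitrary: k)
  case 0
  show ?case
    by (simp only: descendants.simps compound_return_left compound_return_right add_0_right)
next
  case (Suc d)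
  have "descendants q k (Suc (Suc d)) = compound (q (Suc k)) (descendants q (Suc k) (Suc d))"
    by (rule descendants.simps)
  also have "\<dots> = compound (q (Suc k)) (compound (descendants q (Suc k) d) (q (Suc (Suc k + d))))"
    by (simp only: Suc)
  also have "\<dots> = compound (descendants q k (Suc d)) (q (Suc (Suc k + d)))"
    by (simp only: compound_assoc descendants.simps)
  finally show ?case by simp
qed

section \<open>Random indices independent of the summands\<close>

context prob_space
begin

text \<open>The index takes countably many values, and on each event that it equals m independence
  factorises the probability. \<open>X\<close> and \<open>Y\<close> may be whole families of
  variables.\<close>

lemma distr_mixture:
  fixes X Y :: "'a \<Rightarrow> 'b" and G :: "'b \<Rightarrow> nat" and F :: "nat \<Rightarrow> 'b \<Rightarrow> nat"
  assumes ind: "indep_var N' X N Y"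
    and G[measurable]: "G \<in> measurable N' (count_space UNIV)"
    and F[measurable]: "\<And>m. F m \<in> measurable N (count_space UNIV)"
    and X: "distr M (count_space UNIV) (\<lambda>\<omega>. G (X \<omega>)) = measure_pmf p"
    and K: "\<And>m. distr M (count_space UNIV) (\<lambda>\<omega>. F m (Y \<omega>)) = measure_pmf (K m)"
  shows "distr M (count_space UNIV) (\<lambda>\<omega>. F (G (X \<omega>)) (Y \<omega>)) = measure_pmf (bind_pmf p K)"
proof (rule measure_eqI)
  have [measurable]: "X \<in> measurable M N'" "Y \<in> measurable M N"
    using indep_var_rv1[OF ind] indep_var_rv2[OF ind] by auto
  have m: "(\<lambda>\<omega>. F (G (X \<omega>)) (Y \<omega>)) \<in> measurable M (count_space UNIV)"
    by (rule measurable_compose_countable[where f = "\<lambda>m \<omega>. F m (Y \<omega>)"]) simp_all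
  fix A assume "A \<in> sets (distr M (count_space UNIV) (\<lambda>\<omega>. F (G (X \<omega>)) (Y \<omega>)))"
  let ?E = "\<lambda>m. {\<omega> \<in> space M. G (X \<omega>) = m \<and> F m (Y \<omega>) \<in> A}"
  have E: "emeasure M (?E m) = ennreal (pmf p m) * emeasure (measure_pmf (K m)) A" for m
  proof -
    have "F m -` A \<inter> space N \<in> sets N" by (rule measurable_sets[OF F]) simp
    then have "prob ((\<lambda>\<omega>. (X \<omega>, Y \<omega>)) -` ((G -` {m} \<inter> space N') \<times> (F m -` A \<inter> space N)) \<inter> space M)
       = prob (X -` (G -` {m} \<inter> space N') \<inter> space M) * prob (Y -` (F m -` A \<inter> space N) \<inter> space M)"
      by (intro indep_varD[OF ind] measurable_sets[OF G]) auto
    moreover have "(\<lambda>\<omega>. (X \<omega>, Y \<omega>)) -` ((G -` {m} \<inter> space N') \<times> (F m -` A \<inter> space N)) \<inter> space M = ?E m"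
      using measurable_space[of X M N'] measurable_space[of Y M N] by auto
    moreover have "X -` (G -` {m} \<inter> space N') \<inter> space M = (\<lambda>\<omega>. G (X \<omega>)) -` {m} \<inter> space M"
      using measurable_space[of X M N'] by auto
    moreover have "prob ((\<lambda>\<omega>. G (X \<omega>)) -` {m} \<inter> space M) = pmf p m"
      using measure_distr[of "\<lambda>\<omega>. G (X \<omega>)" M "count_space UNIV" "{m}"] by (simp add: X pmf.rep_eq)
    moreover have "Y -` (F m -` A \<inter> space N) \<inter> space M = (\<lambda>\<omega>. F m (Y \<omega>)) -` A \<inter> space M"
      using measurable_space[of Y M N] by auto
    moreover have "prob ((\<lambda>\<omega>. F m (Y \<omega>)) -` A \<inter> space M) = measure (measure_pmf (K m)) A"
      using measure_distr[of "\<lambda>\<omega>. F m (Y \<omega>)" M "count_space UNIV" A] by (simp add: K)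
    ultimately show ?thesis
      by (simp add: emeasure_eq_measure measure_pmf.emeasure_eq_measure ennreal_mult)
  qed
  have "emeasure (distr M (count_space UNIV) (\<lambda>\<omega>. F (G (X \<omega>)) (Y \<omega>))) A = emeasure M (\<Union>m. ?E m)"
    using m by (simp add: emeasure_distr) (intro arg_cong[of _ _ "emeasure M"], auto)
  also have "\<dots> = (\<Sum>m. emeasure M (?E m))"
    by (intro suminf_emeasure[symmetric]) (auto simp: disjoint_family_on_def)
  also have "\<dots> = emeasure (measure_pmf (bind_pmf p K)) A"
    by (simp add: E nn_integral_measure_pmf nn_integral_count_space_nat)
  finally show "emeasure (distr M (count_space UNIV) (\<lambda>\<omega>. F (G (X \<omega>)) (Y \<omega>))) A
    = emeasure (measure_pmf (bind_pmf p K)) A" .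
qed simp

end

lemma measurable_sum_nat:
  fixes f :: "'b \<Rightarrow> 'a \<Rightarrow> nat"
  assumes "\<And>i. i \<in> A \<Longrightarrow> f i \<in> measurable N (count_space UNIV)"
  shows "(\<lambda>x. \<Sum>i\<in>A. f i x) \<in> measurable N (count_space UNIV)"
proof (cases "finite A")
  case True
  then show ?thesis using assms
  proof (induction A)
    case (insert i A)
    then have [measurable]: "f i \<in> measurable N (count_space UNIV)"
      "(\<lambda>x. \<Sum>i\<in>A. f i x) \<in> measurable N (count_space UNIV)" by auto
    show ?case using insert by simp
  qed simp
qed simp

lemma measurable_gw_process:
  assumes "\<And>k i. 1 \<le> k \<Longrightarrow> k \<le> n \<Longrightarrow> 1 \<le> i \<Longrightarrow> \<xi> k i \<in> measurable N (count_space UNIV)"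
  shows "gw_process \<xi> n \<in> measurable N (count_space UNIV)"
  using assms
proof (induction n)
  case 0
  have "gw_process \<xi> 0 = (\<lambda>_. 1)" by (simp add: fun_eq_iff)
  then show ?case by simp
next
  case (Suc n)
  have Z: "gw_process \<xi> n \<in> measurable N (count_space UNIV)" using Suc by auto
  have "(\<lambda>\<omega>. \<Sum>i=1..m. \<xi> (Suc n) i \<omega>) \<in> measurable N (count_space UNIV)" for m
    using Suc.prems by (intro measurable_sum_nat) auto
  then have "(\<lambda>\<omega>. \<Sum>i=1..gw_process \<xi> n \<omega>. \<xi> (Suc n) i \<omega>) \<in> measurable N (count_space UNIV)"
    by (rule measurable_compose_countable[OF _ Z])
  moreover have "gw_process \<xi> (Suc n) = (\<lambda>\<omega>. \<Sum>i=1..gw_process \<xi> n \<omega>. \<xi> (Suc n) i \<omega>)"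
    by (simp add: fun_eq_iff)
  ultimately show ?case by simp
qed

text \<open>The two sample points may live in different spaces, so the process can be read off a
  restricted family in a product space.\<close>

lemma gw_process_cong:
  assumes "\<And>k i. 1 \<le> k \<Longrightarrow> k \<le> n \<Longrightarrow> 1 \<le> i \<Longrightarrow> \<xi> k i \<omega> = \<eta> k i \<omega>'"
  shows "gw_process \<xi> n \<omega> = gw_process \<eta> n \<omega>'"
  using assms by (induction n) (auto intro!: sum.cong)

section \<open>The law of the process and its law given survival\<close>

context prob_space
begin

context
  fixes q :: "nat \<Rightarrow> nat pmf" and \<xi> :: "nat \<Rightarrow> nat \<Rightarrow> 'a \<Rightarrow> nat"
  assumes fam: "offspring_family M q \<xi>"
begin

lemma offspring_indep: "indep_vars (\<lambda>_. count_space UNIV) (\<lambda>(n, i). \<xi> n i) ({1..} \<times> {1..})"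
  using fam by (simp add: offspring_family_def)

lemma offspring_distr: "1 \<le> n \<Longrightarrow> 1 \<le> i \<Longrightarrow> distr M (count_space UNIV) (\<xi> n i) = measure_pmf (q n)"
  using fam by (simp add: offspring_family_def)

lemma offspring_measurable: "1 \<le> n \<Longrightarrow> 1 \<le> i \<Longrightarrow> \<xi> n i \<in> measurable M (count_space UNIV)"
  using offspring_indep by (auto simp: indep_vars_def)

lemma distr_offspring_sum:
  assumes "1 \<le> n"
  shows "distr M (count_space UNIV) (\<lambda>\<omega>. \<Sum>i=1..m. \<xi> n i \<omega>) = measure_pmf (iid_sum (q n) m)"
proof (induction m)
  case 0
  show ?case
    by (simp add: return_pmf.rep_eq distr_const)
next
  case (Suc m)
  let ?A = "{n} \<times> {1..m}" and ?B = "{(n, Suc m)}"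
  let ?R = "\<lambda>C \<omega>. restrict (\<lambda>x. (case x of (n, i) \<Rightarrow> \<xi> n i) \<omega>) C"
  let ?P = "\<lambda>C. PiM C (\<lambda>_. count_space UNIV :: nat measure)"
  have "indep_var (?P ?A) (?R ?A) (?P ?B) (?R ?B)"
    using assms by (intro indep_var_restrict[OF offspring_indep]) auto
  then have "indep_var (count_space UNIV) ((\<lambda>y. \<Sum>i=1..m. y (n, i)) \<circ> ?R ?A)
      (count_space UNIV) ((\<lambda>y. y (n, Suc m)) \<circ> ?R ?B)"
  proof (rule indep_var_compose)
    show "(\<lambda>y. \<Sum>i=1..m. y (n, i)) \<in> measurable (?P ?A) (count_space UNIV)"
      by (intro measurable_sum_nat measurable_component_singleton) auto
    show "(\<lambda>y. y (n, Suc m)) \<in> measurable (?P ?B) (count_space UNIV)"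
      by (intro measurable_component_singleton) simp
  qed
  also have "(\<lambda>y. \<Sum>i=1..m. y (n, i)) \<circ> ?R ?A = (\<lambda>\<omega>. \<Sum>i=1..m. \<xi> n i \<omega>)"
    by (auto simp: fun_eq_iff)
  also have "(\<lambda>y. y (n, Suc m)) \<circ> ?R ?B = \<xi> n (Suc m)"
    by (auto simp: fun_eq_iff)
  finally have ind: "indep_var (count_space UNIV) (\<lambda>\<omega>. \<Sum>i=1..m. \<xi> n i \<omega>)
      (count_space UNIV) (\<xi> n (Suc m))" .
  have "distr M (count_space UNIV) (\<lambda>\<omega>. s + \<xi> n (Suc m) \<omega>) = measure_pmf (map_pmf (\<lambda>x. s + x) (q n))"
    for s
  proof -
    have "distr (distr M (count_space UNIV) (\<xi> n (Suc m))) (count_space UNIV) (\<lambda>x. s + x)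
       = distr M (count_space UNIV) (\<lambda>\<omega>. s + \<xi> n (Suc m) \<omega>)"
      using offspring_measurable[OF assms, of "Suc m"] by (simp add: distr_distr o_def)
    then show ?thesis using offspring_distr[OF assms, of "Suc m"] by (simp add: map_pmf_rep_eq)
  qed
  from distr_mixture[where G = "\<lambda>x. x", OF ind _ _ Suc.IH this] show ?case by simp
qed

text \<open>Z_n is a function of the offspring numbers of generations 1 to n, which as a block are
  independent of generation n + 1; \<open>distr_mixture\<close> then adds one compounding on the
  right.\<close>

lemma distr_gw_process:
  "distr M (count_space UNIV) (gw_process \<xi> n) = measure_pmf (descendants q 0 n)"
proof (induction n)
  case 0
  have "gw_process \<xi> 0 = (\<lambda>_. 1)" by (simp add: fun_eq_iff)
  then show ?case by (simp add: return_pmf.rep_eq distr_const)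
next
  case (Suc n)
  let ?A = "{1..n} \<times> {1..}" and ?B = "{Suc n} \<times> {1..}"
  let ?R = "\<lambda>C \<omega>. restrict (\<lambda>x. (case x of (n, i) \<Rightarrow> \<xi> n i) \<omega>) C"
  let ?P = "\<lambda>C. PiM C (\<lambda>_. count_space UNIV :: nat measure)"
  let ?Z = "gw_process (\<lambda>k i y. y (k, i)) n"
  have "indep_var (?P ?A) (?R ?A) (?P ?B) (?R ?B)"
    by (intro indep_var_restrict[OF offspring_indep]) auto
  note ind = this
  have Z: "?Z \<in> measurable (?P ?A) (count_space UNIV)"
    by (intro measurable_gw_process measurable_component_singleton) auto
  have ZR: "?Z (?R ?A \<omega>) = gw_process \<xi> n \<omega>" for \<omega>
    by (intro gw_process_cong) auto
  have "distr M (count_space UNIV) (\<lambda>\<omega>. ?Z (?R ?A \<omega>)) = measure_pmf (descendants q 0 n)"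
    unfolding ZR by (rule Suc.IH)
  note law = this
  have meas: "(\<lambda>y. \<Sum>i=1..m. y (Suc n, i)) \<in> measurable (?P ?B) (count_space UNIV)" for m
    by (intro measurable_sum_nat measurable_component_singleton) auto
  have sum: "(\<Sum>i=1..m. ?R ?B \<omega> (Suc n, i)) = (\<Sum>i=1..m. \<xi> (Suc n) i \<omega>)" for m \<omega>
    by (intro sum.cong) auto
  have "distr M (count_space UNIV) (\<lambda>\<omega>. \<Sum>i=1..m. ?R ?B \<omega> (Suc n, i))
      = measure_pmf (iid_sum (q (Suc n)) m)" for m
    unfolding sum by (rule distr_offspring_sum) simp
  from distr_mixture[where X = "?R ?A" and Y = "?R ?B" and K = "iid_sum (q (Suc n))"
    and F = "\<lambda>m y. \<Sum>i=1..m. y (Suc n, i)", OF ind Z meas law this]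
  have "distr M (count_space UNIV) (\<lambda>\<omega>. \<Sum>i=1..gw_process \<xi> n \<omega>. \<xi> (Suc n) i \<omega>)
     = measure_pmf (descendants q 0 (Suc n))"
    unfolding sum ZR descendants_Suc_right compound_def by simp
  moreover have "gw_process \<xi> (Suc n) = (\<lambda>\<omega>. \<Sum>i=1..gw_process \<xi> n \<omega>. \<xi> (Suc n) i \<omega>)"
    by (simp add: fun_eq_iff)
  ultimately show ?case by simp
qed

lemma gw_process_measurable: "gw_process \<xi> n \<in> measurable M (count_space UNIV)"
  by (intro measurable_gw_process offspring_measurable)

lemma integral_cond_survival:
  fixes G :: "nat \<Rightarrow> real"
  assumes "pmf (descendants q 0 n) 0 < 1"
  shows "(\<integral>\<omega>. G (gw_process \<xi> n \<omega>) \<partial>cond_survival M \<xi> n) =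
    (\<integral>j. (if j = 0 then 0 else G j) \<partial>measure_pmf (descendants q 0 n)) / (1 - pmf (descendants q 0 n) 0)"
proof -
  let ?Z = "gw_process \<xi> n" and ?P = "descendants q 0 n"
  let ?u = "1 - pmf ?P 0"
  let ?A = "{\<omega> \<in> space M. ?Z \<omega> > 0}"
  note Z[measurable] = gw_process_measurable[of n]
  have int: "(\<integral>\<omega>. H (?Z \<omega>) \<partial>M) = (\<integral>j. H j \<partial>measure_pmf ?P)" for H :: "nat \<Rightarrow> real"
    using integral_distr[of ?Z M "count_space UNIV" H] by (simp add: distr_gw_process)
  have A: "?A = ?Z -` {1..} \<inter> space M" by auto
  have "emeasure M ?A = emeasure (measure_pmf ?P) {1..}"
    unfolding A distr_gw_process[symmetric] by (subst emeasure_distr) auto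
  also have "{1..} = UNIV - {0::nat}" by auto
  also have "emeasure (measure_pmf ?P) \<dots> = ennreal ?u"
    using measure_pmf.prob_compl[of "{0}" ?P] by (simp add: measure_pmf.emeasure_eq_measure pmf.rep_eq)
  finally have em: "emeasure M ?A = ennreal ?u" .
  \<comment> \<open>The extended-real density of \<open>uniform_measure\<close> is rewritten with
    real values so that the Bochner integral can be evaluated.\<close>
  have "cond_survival M \<xi> n = density M (\<lambda>\<omega>. ennreal (indicator ?A \<omega> / ?u))"
    unfolding cond_survival_def uniform_measure_def em
    using assms by (intro density_cong) (auto simp: indicator_def divide_ennreal[of 1, simplified, symmetric])
  then have "(\<integral>\<omega>. G (?Z \<omega>) \<partial>cond_survival M \<xi> n) = (\<integral>\<omega>. indicator ?A \<omega> / ?u * G (?Z \<omega>) \<partial>M)"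
    using assms by (simp add: integral_density)
  also have "\<dots> = (\<integral>\<omega>. (if ?Z \<omega> = 0 then 0 else G (?Z \<omega>)) / ?u \<partial>M)"
    by (intro Bochner_Integration.integral_cong) (auto simp: indicator_def)
  also have "\<dots> = (\<integral>j. (if j = 0 then 0 else G j) \<partial>measure_pmf ?P) / ?u"
    using int[of "\<lambda>j. (if j = 0 then 0 else G j) / ?u"] by simp
  finally show ?thesis .
qed

end

end

section \<open>Environments with a cubic moment bound\<close>

lemma factorial_moment_1: "factorial_moment 1 p = (\<integral>\<^sup>+ k. of_nat k \<partial>measure_pmf p)"
  by (simp add: factorial_moment_def)

lemma factorial_moment_2:
  "factorial_moment 2 p = (\<integral>\<^sup>+ k. ennreal (real k * (real k - 1)) \<partial>measure_pmf p)"
proof -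
  have "of_nat (\<Prod>i<2. k - i) = ennreal (real k * (real k - 1))" for k
  proof -
    have "real (\<Prod>i<2. k - i) = real k * (real k - 1)" by (cases k) (auto simp: numeral_2_eq_2 algebra_simps)
    then show ?thesis unfolding ennreal_of_nat_eq_real_of_nat by (rule arg_cong)
  qed
  then show ?thesis by (simp add: factorial_moment_def)
qed

lemma factorial_moment_3:
  "factorial_moment 3 p = (\<integral>\<^sup>+ k. ennreal (real k * (real k - 1) * (real k - 2)) \<partial>measure_pmf p)"
proof -
  have "of_nat (\<Prod>i<3. k - i) = ennreal (real k * (real k - 1) * (real k - 2))" for k
  proof -
    consider "k = 0" | "k = 1" | "k \<ge> 2" by linarith
    then show ?thesis unfolding ennreal_of_nat_eq_real_of_nat
      by cases (auto simp: numeral_3_eq_3 of_nat_diff)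
  qed
  then show ?thesis by (simp add: factorial_moment_def)
qed

lemma pmf_compound_0: "pmf (compound p r) 0 = gf p (pmf r 0)"
proof -
  have "ennreal (pmf (compound p r) 0) = egf p (ennreal (pmf r 0))"
    using egf_compound[of p r 0] egf_eq_gf[of 0 "compound p r"] egf_eq_gf[of 0 r] by (simp add: gf_0)
  also have "\<dots> = ennreal (gf p (pmf r 0))" by (simp add: egf_eq_gf pmf_le_1)
  finally show ?thesis using gf_bounds[of "pmf r 0" p] by (simp add: pmf_le_1)
qed

text \<open>The constant is normalised to \<open>c \<ge> 1\<close>. Read in \<open>ennreal\<close>,
  the cubic bound also yields a finite third moment, because the first two are finite.\<close>

locale cubic_environment =
  fixes q :: "nat \<Rightarrow> nat pmf" and c :: real
  assumes env: "environment q" and c1: "1 \<le> c"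
    and cubic: "\<And>n. 1 \<le> n \<Longrightarrow> factorial_moment 3 (q n)
      \<le> ennreal c * factorial_moment 2 (q n) * (1 + factorial_moment 1 (q n))"
begin

lemma second_moment_finite: "1 \<le> n \<Longrightarrow> (\<integral>\<^sup>+ k. ennreal (real k ^ 2) \<partial>measure_pmf (q n)) < \<infinity>"
  using env by (simp add: environment_def ennreal_of_nat_eq_real_of_nat)

lemma offspring_nonzero:
  assumes "1 \<le> n"
  shows "\<exists>j\<in>set_pmf (q n). j \<noteq> 0"
proof (rule ccontr)
  assume "\<not> ?thesis"
  then have "(\<integral>\<^sup>+ k. of_nat k \<partial>measure_pmf (q n)) = (\<integral>\<^sup>+ k. 0 \<partial>measure_pmf (q n))"
    by (intro nn_integral_cong_AE) (auto simp: AE_measure_pmf_iff)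
  then show False using env assms by (auto simp: environment_def)
qed

lemma integrable_square: "1 \<le> n \<Longrightarrow> integrable (measure_pmf (q n)) (\<lambda>k. real k ^ 2)"
  using second_moment_finite by (intro integrableI_nonneg) auto

lemma integrable_mean: "1 \<le> n \<Longrightarrow> integrable (measure_pmf (q n)) real"
  using integrable_power_le[OF integrable_square, of n 1] by simp

lemma integrable_falling_2:
  assumes n: "1 \<le> n"
  shows "integrable (measure_pmf (q n)) (\<lambda>k. real k * (real k - 1))"
  using Bochner_Integration.integrable_diff[OF integrable_square[OF n] integrable_mean[OF n]]
  by (simp add: algebra_simps power2_eq_square)

lemma factorial_moment_1_eq: "1 \<le> n \<Longrightarrow> factorial_moment 1 (q n) = ennreal (mom1 (q n))"
  using integrable_mean[of n]
  by (simp add: factorial_moment_def mom1_def ennreal_of_nat_eq_real_of_nat nn_integral_eq_integral)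

lemma factorial_moment_2_eq: "1 \<le> n \<Longrightarrow> factorial_moment 2 (q n) = ennreal (mom2 (q n))"
  using integrable_falling_2[of n] falling_nonneg(1)
  by (simp add: factorial_moment_2 mom2_def nn_integral_eq_integral)

lemma mom1_eq:
  assumes n: "1 \<le> n"
  shows "mom1 (q n) = fd1 q n"
  unfolding fd1_def factorial_moment_1_eq[OF n]
  using mom1_pos[OF integrable_mean offspring_nonzero, OF n n] by simp

lemma mom2_eq: "1 \<le> n \<Longrightarrow> mom2 (q n) = fd2 q n"
  using mom2_nonneg[of "q n"] by (simp add: fd2_def factorial_moment_2_eq)

lemma fd1_pos: "1 \<le> n \<Longrightarrow> 0 < fd1 q n"
  using mom1_pos[OF integrable_mean offspring_nonzero, of n] by (simp add: mom1_eq)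

lemma cubic_real:
  assumes n: "1 \<le> n"
  shows "factorial_moment 3 (q n) \<le> ennreal (c * mom2 (q n) * (1 + mom1 (q n)))"
proof -
  have "1 + ennreal (mom1 (q n)) = ennreal (1 + mom1 (q n))"
    using mom1_pos[OF integrable_mean offspring_nonzero, OF n n] by simp
  then show ?thesis
    using cubic[OF n] mom2_nonneg[of "q n"] mom1_pos[OF integrable_mean offspring_nonzero, OF n n] c1
    unfolding factorial_moment_1_eq[OF n] factorial_moment_2_eq[OF n] by (simp add: ennreal_mult)
qed

lemma integrable_cube:
  assumes n: "1 \<le> n"
  shows "integrable (measure_pmf (q n)) (\<lambda>k. real k ^ 3)"
proof (rule Bochner_Integration.integrable_bound)
  have "(\<integral>\<^sup>+ k. ennreal (real k * (real k - 1) * (real k - 2)) \<partial>measure_pmf (q n)) < \<infinity>"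
    using cubic_real[OF n] unfolding factorial_moment_3 by (rule le_less_trans) simp
  then have "integrable (measure_pmf (q n)) (\<lambda>k. real k * (real k - 1) * (real k - 2))"
    using falling_nonneg(2) by (intro integrableI_nonneg) auto
  then show "integrable (measure_pmf (q n)) (\<lambda>k. real k * (real k - 1) * (real k - 2) + 3 * real k ^ 2)"
    using integrable_square[OF n] by simp
  \<comment> \<open>The two sides differ by \<open>2 * real k\<close>.\<close>
  have "real k ^ 3 \<le> real k * (real k - 1) * (real k - 2) + 3 * real k ^ 2" for k
    by (simp add: algebra_simps power2_eq_square power3_eq_cube)
  then show "AE k in measure_pmf (q n). norm (real k ^ 3)
      \<le> norm (real k * (real k - 1) * (real k - 2) + 3 * real k ^ 2)"
    by (intro AE_pmfI) (smt (verit) real_norm_def of_nat_0_le_iff zero_le_power)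
qed simp

lemma mom3_le:
  assumes n: "1 \<le> n"
  shows "mom3 (q n) \<le> c * mom2 (q n) * (1 + mom1 (q n))"
proof -
  have "ennreal (mom3 (q n)) = factorial_moment 3 (q n)"
    unfolding factorial_moment_3 mom3_def
    using integrable_falling(3)[OF integrable_cube[OF n]] falling_nonneg(2)
    by (intro nn_integral_eq_integral[symmetric]) auto
  then have "ennreal (mom3 (q n)) \<le> ennreal (c * mom2 (q n) * (1 + mom1 (q n)))"
    using cubic_real[OF n] by simp
  then show ?thesis
    using mom2_nonneg[of "q n"] fd1_pos[OF n] c1 by (simp add: mom1_eq[OF n])
qed

section \<open>The sequences mu and rho and the mean number of descendants\<close>

lemma mu_Suc: "mu q (Suc n) = mu q n * fd1 q (Suc n)"
  by (simp add: mu_def)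

lemma mu_pos: "0 < mu q n"
  unfolding mu_def using fd1_pos by (intro prod_pos) auto

lemma nu_nonneg: "1 \<le> n \<Longrightarrow> 0 \<le> nu q n"
  using mom2_nonneg[of "q n"] by (simp add: nu_def mom2_eq)

lemma rho_mono: "k \<le> n \<Longrightarrow> rho q k \<le> rho q n"
  unfolding rho_def
  using nu_nonneg mu_pos by (intro sum_mono2) (auto intro!: divide_nonneg_pos)

lemma descendants_mean:
  "(\<integral>\<^sup>+ j. of_nat j \<partial>measure_pmf (descendants q k d)) = ennreal (mu q (k + d) / mu q k)"
proof (induction d arbitrary: k)
  case 0
  then show ?case using mu_pos[of k] by simp
next
  case (Suc d)
  have "(\<integral>\<^sup>+ j. of_nat j \<partial>measure_pmf (descendants q k (Suc d)))
      = ennreal (fd1 q (Suc k)) * ennreal (mu q (Suc k + d) / mu q (Suc k))"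
    unfolding descendants.simps nn_mean_compound Suc
    using factorial_moment_1_eq[of "Suc k"] by (simp add: factorial_moment_1[simplified] mom1_eq)
  also have "\<dots> = ennreal (fd1 q (Suc k) * (mu q (Suc k + d) / mu q (Suc k)))"
    using fd1_pos[of "Suc k"] by (intro ennreal_mult'[symmetric]) simp
  also have "fd1 q (Suc k) * (mu q (Suc k + d) / mu q (Suc k)) = mu q (k + Suc d) / mu q k"
    using fd1_pos[of "Suc k"] by (simp add: mu_Suc)
  finally show ?case .
qed

lemma descendants_mean_pos: "0 < mu q (k + d) / mu q k"
  using mu_pos by simp

lemmas descendants_facts = nn_mean_facts[OF descendants_mean descendants_mean_pos]

section \<open>Survival up to time n of the line of an individual of generation k\<close>

definition survival :: "nat \<Rightarrow> nat \<Rightarrow> real" where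
  "survival n k = 1 - pmf (descendants q k (n - k)) 0"

lemma survival_pos: "0 < survival n k"
  unfolding survival_def
  using secant_pos[OF descendants_facts(1), of 0 k "n - k"] descendants_facts(3)
    secant_eq[OF descendants_facts(1), of 0 k "n - k"]
  by (simp add: gf_0)

lemma survival_le_1: "survival n k \<le> 1"
  by (simp add: survival_def)

lemma survival_self: "survival n n = 1"
  by (simp add: survival_def)

lemma survival_recursion:
  assumes "k < n"
  shows "survival n k = 1 - gf (q (Suc k)) (1 - survival n (Suc k))"
proof -
  have "n - k = Suc (n - Suc k)" using assms by simp
  then show ?thesis by (simp add: survival_def pmf_compound_0)
qed

text \<open>Kersting's recursion for \<open>1 / (1 - f)\<close> along compositions of generating functions.\<close>

lemma survival_lower:
  assumes "k \<le> n"
  shows "1 / mu q n + (rho q n - rho q k) / (6 * c) \<le> 1 / (mu q k * survival n k)"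
  using assms
proof (induction k rule: inc_induct)
  case base
  then show ?case by (simp add: survival_self)
next
  case (step k)
  let ?p = "q (Suc k)" and ?u = "survival n (Suc k)"
  have rho: "rho q (Suc k) = rho q k + nu q (Suc k) / mu q k" by (simp add: rho_def)
  \<comment> \<open>The shape function bound at the extinction probability
    \<open>1 - survival n (Suc k)\<close>.\<close>
  have "1 / (fd1 q (Suc k) * ?u) + nu q (Suc k) / (6 * c) \<le> 1 / survival n k"
    using shape_function_ge[OF integrable_cube offspring_nonzero _ _ c1 mom3_le, of "Suc k" "1 - ?u"]
      survival_pos[of n "Suc k"] survival_le_1[of n "Suc k"] step(2)
    by (simp add: survival_recursion nu_def mom1_eq mom2_eq)
  \<comment> \<open>Division by \<open>mu q k\<close> turns the increment into the next summand of
    \<open>rho\<close>, so the recursion telescopes.\<close>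
  then have "(1 / (fd1 q (Suc k) * ?u) + nu q (Suc k) / (6 * c)) / mu q k \<le> (1 / survival n k) / mu q k"
    using mu_pos[of k] by (intro divide_right_mono) auto
  then have "1 / (mu q (Suc k) * ?u) + nu q (Suc k) / mu q k / (6 * c) \<le> 1 / (mu q k * survival n k)"
    by (simp add: mu_Suc add_divide_distrib mult_ac)
  then show ?case using step.IH unfolding rho by (simp add: diff_divide_distrib add_divide_distrib)
qed

lemma survival_upper:
  assumes "k \<le> n" "rho q k < rho q n"
  shows "survival n k \<le> 6 * c / (mu q k * (rho q n - rho q k))"
proof -
  have "(rho q n - rho q k) / (6 * c) \<le> 1 / (mu q k * survival n k)"
    using survival_lower[OF assms(1)] mu_pos[of n] by (smt (verit) divide_pos_pos)
  then show ?thesis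
    using assms(2) mu_pos[of k] survival_pos[of n k] c1 by (simp add: field_simps)
qed

section \<open>The errors contributed by the generations\<close>

definition gap_term :: "nat \<Rightarrow> nat \<Rightarrow> real" where
  "gap_term n j = survival n j * (nu q j * (1 + fd1 q j) / mu q (j - 1))"

lemma gap_term_nonneg: "1 \<le> j \<Longrightarrow> 0 \<le> gap_term n j"
  using survival_pos[of n j] nu_nonneg[of j] fd1_pos[of j] mu_pos[of "j - 1"] by (simp add: gap_term_def)

text \<open>Backward induction with \<open>secant_gap_compound\<close>. The error of generation j is
  multiplied by the mean number \<open>mu q n / mu q j\<close> of descendants; rewriting
  \<open>mom2 / mom1\<close> through \<open>nu\<close> leaves \<open>mu q n * gap_term n j\<close>
  up to the constant.\<close>

lemma secant_gap_descendants:
  assumes "k \<le> n"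
  shows "secant_gap (descendants q k (n - k)) (2 * (c + 1) * mu q n * (\<Sum>j=Suc k..n. gap_term n j))"
  using assms
proof (induction k rule: inc_induct)
  case base
  then show ?case using secant_gap_return_1 by simp
next
  case (step k)
  let ?p = "q (Suc k)" and ?r = "descendants q (Suc k) (n - Suc k)"
  have m: "mom1 ?r = mu q n / mu q (Suc k)"
    using descendants_facts(2)[of "Suc k" "n - Suc k"] step(2) by simp
  have eq: "n - k = Suc (n - Suc k)" using step(2) by simp
  have "secant_gap (descendants q k (n - k)) (2 * (c + 1) * mu q n * (\<Sum>j=Suc (Suc k)..n. gap_term n j)
     + mom1 ?r * (2 * (c + 1) * (1 - pmf ?r 0) * (mom2 ?p / mom1 ?p * (1 + mom1 ?p))))"
    unfolding eq descendants.simps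
    using c1 by (intro secant_gap_compound step.IH descendants_facts integrable_cube offspring_nonzero mom3_le) auto
  also have "mom1 ?r * (2 * (c + 1) * (1 - pmf ?r 0) * (mom2 ?p / mom1 ?p * (1 + mom1 ?p)))
      = 2 * (c + 1) * mu q n * gap_term n (Suc k)"
    using fd1_pos[of "Suc k"]
    by (simp add: m gap_term_def survival_def mom1_eq mom2_eq nu_def mu_Suc power2_eq_square mult_ac)
  finally show ?case
    using step(2) by (simp add: sum.atLeast_Suc_atMost[of "Suc k" n] algebra_simps)
qed

lemma gap_terms_le_remainder:
  assumes "1 \<le> n"
  shows "ennreal (\<Sum>j=1..n. gap_term n j) \<le> ennreal (6 * c) * remainder q n"
proof -
  have term_le: "ennreal (gap_term n j) \<le> ennreal (6 * c) * (ennreal (nu q j / mu q (j - 1)) *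
        (ennreal (1 + fd1 q j) / ennreal (mu q j * (rho q n - rho q j))))" if j: "j \<in> {1..n - 1}" for j
  proof -
    have j': "1 \<le> j" "j \<le> n" using j by auto
    let ?w = "nu q j / mu q (j - 1)" and ?f = "1 + fd1 q j" and ?D = "mu q j * (rho q n - rho q j)"
    have w: "0 \<le> ?w" and f: "0 < ?f" using nu_nonneg[OF j'(1)] mu_pos[of "j - 1"] fd1_pos[OF j'(1)] by auto
    have gt: "gap_term n j = survival n j * (?w * ?f)" by (simp add: gap_term_def)
    \<comment> \<open>For \<open>nu q j = 0\<close> the gap term vanishes. For
      \<open>nu q j > 0\<close> with vanishing denominator the summand of the remainder is infinite.
      Otherwise \<open>survival_upper\<close> applies.\<close>
    consider "nu q j = 0" | "0 < nu q j" "rho q n = rho q j" | "rho q j < rho q n"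
      using rho_mono[OF j'(2)] nu_nonneg[OF j'(1)] by linarith
    then show ?thesis
    proof cases
      case 1
      then show ?thesis by (simp add: gt)
    next
      case 2
      have "ennreal ?f / ennreal ?D = \<infinity>" using 2 f by (simp add: ennreal_divide_eq_top_iff)
      then show ?thesis using 2 mu_pos[of "j - 1"] c1 by (simp add: ennreal_mult_eq_top_iff)
    next
      case 3
      then have D: "0 < ?D" using mu_pos[of j] by simp
      have "gap_term n j \<le> 6 * c / ?D * (?w * ?f)"
        unfolding gt
        by (rule mult_right_mono[OF survival_upper[OF j'(2) 3] mult_nonneg_nonneg[OF w less_imp_le[OF f]]])
      also have "\<dots> = 6 * c * (?w * (?f / ?D))" by simp
      finally have "ennreal (gap_term n j) \<le> ennreal (6 * c * (?w * (?f / ?D)))" by (rule ennreal_leI)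
      also have "\<dots> = ennreal (6 * c) * ennreal (?w * (?f / ?D))"
        using c1 by (intro ennreal_mult') simp
      also have "ennreal (?w * (?f / ?D)) = ennreal ?w * ennreal (?f / ?D)"
        by (rule ennreal_mult'[OF w])
      also have "ennreal (?f / ?D) = ennreal ?f / ennreal ?D"
        by (rule divide_ennreal[OF less_imp_le[OF f] D, symmetric])
      finally show ?thesis .
    qed
  qed
  have last: "ennreal (gap_term n n) \<le> ennreal (6 * c) * ennreal (nu q n / mu q (n - 1) * (1 + fd1 q n))"
  proof -
    have nn: "0 \<le> nu q n / mu q (n - 1) * (1 + fd1 q n)"
      using nu_nonneg[OF assms] mu_pos[of "n - 1"] fd1_pos[OF assms] by simp
    \<comment> \<open>At time n survival is certain, and the factor 1 is at most
      \<open>6 * c\<close>.\<close>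
    have "gap_term n n = 1 * (nu q n / mu q (n - 1) * (1 + fd1 q n))"
      by (simp add: gap_term_def survival_self)
    also have "\<dots> \<le> 6 * c * (nu q n / mu q (n - 1) * (1 + fd1 q n))"
      using nn c1 by (intro mult_right_mono) auto
    finally show ?thesis using nn c1 by (simp add: ennreal_mult[symmetric] ennreal_leI)
  qed
  have "{1..n} = insert n {1..n - 1}" using assms by auto
  then have "(\<Sum>j=1..n. gap_term n j) = (\<Sum>j=1..n - 1. gap_term n j) + gap_term n n"
    using assms by simp
  then have "ennreal (\<Sum>j=1..n. gap_term n j)
      = ennreal (\<Sum>j=1..n - 1. gap_term n j) + ennreal (gap_term n n)"
    by (simp only:) (intro ennreal_plus sum_nonneg gap_term_nonneg, use assms in auto)
  also have "\<dots> = (\<Sum>j=1..n - 1. ennreal (gap_term n j)) + ennreal (gap_term n n)"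
    using gap_term_nonneg by (subst sum_ennreal) auto
  also have "\<dots> \<le> ennreal (6 * c) * remainder q n"
    unfolding remainder_def distrib_left[of "ennreal (6 * c)"] sum_distrib_left
    by (intro add_mono sum_mono term_le last)
  finally show ?thesis .
qed

text \<open>Here \<open>1 / b\<close> is the survival probability over \<open>mu q n\<close>, at
  most a multiple of \<open>1 / (mu q n * rho q n)\<close>. The factor \<open>mu q n\<close> in the
  secant gap cancels against it.\<close>

lemma conditional_law_distance:
  assumes n: "1 \<le> n" and rho: "0 < rho q n"
    and h: "\<And>x y. \<bar>h x - h y\<bar> \<le> \<bar>x - y\<bar>"
    and P: "P = descendants q 0 n" and b: "b = mu q n / (1 - pmf P 0)"
  shows "\<bar>(\<integral>j. (if j = 0 then 0 else h (real j / b)) \<partial>measure_pmf P) / (1 - pmf P 0)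
      - (\<integral>t. h t \<partial>std_exponential)\<bar>
    \<le> 12 * c / (mu q n * rho q n) + 24 * c * (c + 1) / rho q n * (\<Sum>j=1..n. gap_term n j)"
proof -
  let ?S = "\<Sum>j=1..n. gap_term n j"
  have S: "0 \<le> ?S" using gap_term_nonneg by (intro sum_nonneg) auto
  have u: "survival n 0 = 1 - pmf P 0" by (simp add: survival_def P)
  have m: "mom1 P = mu q n" using descendants_facts(2)[of 0 n] by (simp add: P mu_def)
  have gap: "secant_gap P (2 * (c + 1) * mu q n * ?S)"
    using secant_gap_descendants[of 0 n] by (simp add: P)
  have "\<bar>(\<integral>j. (if j = 0 then 0 else h (real j / b)) \<partial>measure_pmf P) / (1 - pmf P 0)
      - (\<integral>t. h t \<partial>std_exponential)\<bar> \<le> 2 / b * (1 + 2 * (c + 1) * mu q n * ?S)"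
    using conditional_exponential_bound[OF h _ _ gap, of b]
      descendants_facts(1,3)[of 0 n] by (simp add: P[symmetric] m b)
  also have "\<dots> \<le> 12 * c / (mu q n * rho q n) * (1 + 2 * (c + 1) * mu q n * ?S)"
  proof (rule mult_right_mono)
    have "survival n 0 \<le> 6 * c / rho q n"
      using survival_upper[of 0 n] rho by (simp add: rho_def[of q 0] mu_def[of q 0])
    then have "2 * survival n 0 / mu q n \<le> 2 * (6 * c / rho q n) / mu q n"
      using mu_pos[of n] by (intro divide_right_mono mult_left_mono) auto
    then show "2 / b \<le> 12 * c / (mu q n * rho q n)" by (simp add: b u mult.commute)
    show "0 \<le> 1 + 2 * (c + 1) * mu q n * ?S"
      using S c1 mu_pos[of n] by (intro add_nonneg_nonneg mult_nonneg_nonneg) auto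
  qed
  also have "\<dots> = 12 * c / (mu q n * rho q n) + 24 * c * (c + 1) / rho q n * ?S"
  proof -
    have "12 * c / (m * r) * (1 + 2 * (c + 1) * m * s) = 12 * c / (m * r) + 24 * c * (c + 1) / r * s"
      if "0 < m" "0 < r" for m r s :: real
      using that by (simp add: field_simps)
    then show ?thesis using mu_pos rho by blast
  qed
  finally show ?thesis .
qed

end

theorem theorem1p4:
  fixes M :: "'a measure"
    and q :: "nat \<Rightarrow> nat pmf"
    and \<xi> :: "nat \<Rightarrow> nat \<Rightarrow> 'a \<Rightarrow> nat"
  assumes "prob_space M"
    and "environment q"
    and "offspring_family M q \<xi>"
    and "critical q"
    and "\<exists>c::real. c > 0 \<and> (\<forall>n\<ge>1. factorial_moment 3 (q n)
            \<le> ennreal c * factorial_moment 2 (q n) * (1 + factorial_moment 1 (q n)))"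
  shows "\<exists>C::real. C > 0 \<and> (\<forall>n\<ge>2.
           wasserstein_dist
             (distr (cond_survival M \<xi> n) borel
                (\<lambda>\<omega>. 1 / cond_mean M \<xi> n * real (gw_process \<xi> n \<omega>)))
             (density lborel (\<lambda>x. ennreal (exponential_density 1 x)))
           \<le> ennreal C *
               (1 / ennreal (mu q n * rho q n) + remainder q n / ennreal (rho q n)))"
proof -
  interpret prob_space M by fact
  from assms(5) obtain c0 :: real where c0: "\<forall>n\<ge>1. factorial_moment 3 (q n)
      \<le> ennreal c0 * factorial_moment 2 (q n) * (1 + factorial_moment 1 (q n))"
    by (elim exE conjE)
  define c where "c = max c0 1"
  interpret cubic_environment q c
  proof
    fix n :: nat assume "1 \<le> n"
    with c0 have "factorial_moment 3 (q n)
      \<le> ennreal c0 * factorial_moment 2 (q n) * (1 + factorial_moment 1 (q n))" by (elim allE impE)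
    also have "ennreal c0 * factorial_moment 2 (q n) * (1 + factorial_moment 1 (q n))
      \<le> ennreal c * factorial_moment 2 (q n) * (1 + factorial_moment 1 (q n))"
      by (intro mult_right_mono ennreal_leI) (auto simp: c_def)
    finally show "factorial_moment 3 (q n)
      \<le> ennreal c * factorial_moment 2 (q n) * (1 + factorial_moment 1 (q n))" .
  next
    show "environment q" by fact
    show "1 \<le> c" by (simp add: c_def)
  qed
  \<comment> \<open>One summand for each part of the bound: \<open>12 * c\<close> for
    \<open>1 / (mu q n * rho q n)\<close>, and \<open>24 * c * (c + 1)\<close> times the
    \<open>6 * c\<close> of \<open>gap_terms_le_remainder\<close> for the remainder.\<close>
  define C where "C = 12 * c + 24 * c * (c + 1) * (6 * c)"
  have C: "0 < C" "12 * c \<le> C" "24 * c * (c + 1) * (6 * c) \<le> C"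
  proof -
    have "0 < 12 * c" "0 \<le> 24 * c * (c + 1) * (6 * c)" using c1 by simp_all
    then show "0 < C" "12 * c \<le> C" "24 * c * (c + 1) * (6 * c) \<le> C"
      unfolding C_def by linarith+
  qed
  have "wasserstein_dist
             (distr (cond_survival M \<xi> n) borel
                (\<lambda>\<omega>. 1 / cond_mean M \<xi> n * real (gw_process \<xi> n \<omega>))) std_exponential
           \<le> ennreal C * (1 / ennreal (mu q n * rho q n) + remainder q n / ennreal (rho q n))"
    if n: "2 \<le> n" for n
  proof (cases "rho q n = 0")
    case True
    \<comment> \<open>With \<open>rho q n = 0\<close> the first term is
      \<open>1 / 0 = \<infinity>\<close> in \<open>ennreal\<close>, and the bound is
      vacuous.\<close>
    then show ?thesis using C by (simp add: ennreal_mult_eq_top_iff)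
  next
    case False
    then have rho: "0 < rho q n" using rho_mono[of 0 n] by (simp add: rho_def[of q 0])
    define P where "P = descendants q 0 n"
    define b where "b = mu q n / (1 - pmf P 0)"
    have u: "pmf (descendants q 0 n) 0 < 1" using survival_pos[of n 0] by (simp add: survival_def)
    \<comment> \<open>The conditional mean is the mean \<open>mu q n\<close> divided by the survival
      probability, which is the scaling used in Stein's method.\<close>
    have "cond_mean M \<xi> n = (\<integral>j. (if j = 0 then 0 else real j) \<partial>measure_pmf P) / (1 - pmf P 0)"
      unfolding cond_mean_def P_def by (rule integral_cond_survival[OF assms(3) u])
    also have "(\<integral>j. (if j = 0 then 0 else real j) \<partial>measure_pmf P) = mom1 P"
      unfolding mom1_def by (intro Bochner_Integration.integral_cong) auto
    also have "mom1 P = mu q n" using descendants_facts(2)[of 0 n] by (simp add: P_def mu_def)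
    finally have b: "cond_mean M \<xi> n = b" by (simp add: b_def)
    have meas: "gw_process \<xi> n \<in> measurable (cond_survival M \<xi> n) (count_space UNIV)"
      using gw_process_measurable[OF assms(3)] by (simp add: cond_survival_def)
    show ?thesis
      unfolding wasserstein_dist_def
    proof (rule SUP_least)
      fix h assume "h \<in> wasserstein_test"
      then have h: "\<bar>h x - h y\<bar> \<le> \<bar>x - y\<bar>" for x y by (rule wasserstein_test_contraction)
      have [measurable]: "h \<in> borel_measurable borel" using h by (rule contraction_measurable)
      let ?S = "\<Sum>j=1..n. gap_term n j"
      have S: "0 \<le> ?S" using gap_term_nonneg by (intro sum_nonneg) auto
      have "(\<integral>x. h x \<partial>distr (cond_survival M \<xi> n) borel
          (\<lambda>\<omega>. 1 / cond_mean M \<xi> n * real (gw_process \<xi> n \<omega>)))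
        = (\<integral>\<omega>. h (real (gw_process \<xi> n \<omega>) / b) \<partial>cond_survival M \<xi> n)"
      proof (subst integral_distr)
        show "(\<lambda>\<omega>. 1 / cond_mean M \<xi> n * real (gw_process \<xi> n \<omega>))
            \<in> borel_measurable (cond_survival M \<xi> n)"
          by (rule measurable_compose[OF meas]) simp
        show "h \<in> borel_measurable borel" by fact
      qed (simp only: b mult_1 times_divide_eq_left)
      also have "\<dots> = (\<integral>j. (if j = 0 then 0 else h (real j / b)) \<partial>measure_pmf P) / (1 - pmf P 0)"
        unfolding P_def by (rule integral_cond_survival[OF assms(3) u])
      finally have "\<bar>(\<integral>x. h x \<partial>distr (cond_survival M \<xi> n) borel
          (\<lambda>\<omega>. 1 / cond_mean M \<xi> n * real (gw_process \<xi> n \<omega>))) - (\<integral>x. h x \<partial>std_exponential)\<bar>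
        \<le> 12 * c / (mu q n * rho q n) + 24 * c * (c + 1) / rho q n * ?S"
        using conditional_law_distance[OF _ rho h P_def b_def] n by simp
      then have "ennreal \<bar>(\<integral>x. h x \<partial>distr (cond_survival M \<xi> n) borel
          (\<lambda>\<omega>. 1 / cond_mean M \<xi> n * real (gw_process \<xi> n \<omega>))) - (\<integral>x. h x \<partial>std_exponential)\<bar>
        \<le> ennreal (12 * c / (mu q n * rho q n) + 24 * c * (c + 1) / rho q n * ?S)"
        by (rule ennreal_leI)
      also have "\<dots> = ennreal (12 * c) * (1 / ennreal (mu q n * rho q n))
          + ennreal (24 * c * (c + 1)) * ennreal ?S / ennreal (rho q n)"
      proof -
        have "ennreal (12 * c / (mu q n * rho q n)) = ennreal (12 * c) * (1 / ennreal (mu q n * rho q n))"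
          using c1 mu_pos[of n] rho divide_ennreal[of "12 * c" "mu q n * rho q n"]
          by (simp only: ennreal_times_divide mult_1_right) simp
        moreover have "ennreal (24 * c * (c + 1) / rho q n * ?S)
            = ennreal (24 * c * (c + 1)) * ennreal ?S / ennreal (rho q n)"
          using c1 rho S divide_ennreal[of "24 * c * (c + 1) * ?S" "rho q n"]
            ennreal_mult[of "24 * c * (c + 1)" "?S"] by simp
        ultimately show ?thesis using c1 mu_pos[of n] rho S by (subst ennreal_plus) auto
      qed
      also have "\<dots> \<le> ennreal C * (1 / ennreal (mu q n * rho q n))
          + ennreal C * remainder q n / ennreal (rho q n)"
      proof (intro add_mono mult_right_mono divide_right_mono_ennreal ennreal_leI C)
        have "ennreal (24 * c * (c + 1)) * ennreal ?S
            \<le> ennreal (24 * c * (c + 1)) * (ennreal (6 * c) * remainder q n)"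
          using gap_terms_le_remainder[of n] n by (intro mult_left_mono) auto
        also have "\<dots> = ennreal (24 * c * (c + 1) * (6 * c)) * remainder q n"
        proof -
          have "0 \<le> 24 * c * (c + 1)" using c1 by simp
          from ennreal_mult'[OF this, of "6 * c"] show ?thesis by (simp only: mult.assoc)
        qed
        also have "\<dots> \<le> ennreal C * remainder q n"
          using C by (intro mult_right_mono ennreal_leI) auto
        finally show "ennreal (24 * c * (c + 1)) * ennreal ?S \<le> ennreal C * remainder q n" .
      qed simp
      also have "\<dots> = ennreal C * (1 / ennreal (mu q n * rho q n) + remainder q n / ennreal (rho q n))"
        by (simp add: distrib_left ennreal_times_divide)
      finally show "ennreal \<bar>(\<integral>x. h x \<partial>distr (cond_survival M \<xi> n) borel
          (\<lambda>\<omega>. 1 / cond_mean M \<xi> n * real (gw_process \<xi> n \<omega>))) - (\<integral>x. h x \<partial>std_exponential)\<bar>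
        \<le> ennreal C * (1 / ennreal (mu q n * rho q n) + remainder q n / ennreal (rho q n))" .
    qed
  qed
  then show ?thesis using C(1) by blast
qed

end
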